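(* Let $G$ and $H$ be finite Abelian groups, let $S$ be a non-empty subset of $G$, and let $\epsilon>0$. Then there exists $A=A(\epsilon,G,S,H)$ such that for every positive integer $n$, every set of $H$-conditions on $G^n$ can be internally $\epsilon$-approximated on $S^n$ by a set of at most $A$ $H$-conditions on $G^n$.
   Context: An $H$-condition on $G^n$ is a pair $(\phi,E)$, where $\phi:G^n\to H$ is a group homomorphism and $E\subset H$. A point $x$ satisfies $(\phi,E)$ if $\phi(x)\in E$. A set $\mathcal{F}$ of $H$-conditions internally $\epsilon$-approximates a set $\mathcal{G}$ of $H$-conditions on $S^n$ if every point of $S^n$ that satisfies all conditions in $\mathcal{F}$ satisfies all conditions in $\mathcal{G}$, and the set of points of $S^n$ that satisfy all conditions in $\mathcal{G}$ but not all conditions in $\mathcal{F}$ has cardinality at most $\epsilon|S^n|$. *)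

theory Defs
  imports Complex_Main "HOL-Algebra.Product_Groups"
begin

text \<open>
  The power \<open>G\<^sup>n\<close>: its points are the functions on \<open>{..<n}\<close> with values in \<open>carrier G\<close>, extended
  by \<open>undefined\<close> outside \<open>{..<n}\<close>, so that the number of points is the expected one.
\<close>

definition group_power :: "('a, 'b) monoid_scheme \<Rightarrow> nat \<Rightarrow> (nat \<Rightarrow> 'a) monoid" where
  "group_power G n = product_group {..<n} (\<lambda>_. G)"

definition set_power :: "'a set \<Rightarrow> nat \<Rightarrow> (nat \<Rightarrow> 'a) set" where
  "set_power S n = {..<n} \<rightarrow>\<^sub>E S"

text \<open>
  The homomorphism is required to be \<open>undefined\<close> outside \<open>G\<^sup>n\<close>, so that two homomorphisms agreeing on
  \<open>G\<^sup>n\<close> are equal and sets of conditions have the intended cardinality.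
\<close>

type_synonym ('a, 'h) cond = "((nat \<Rightarrow> 'a) \<Rightarrow> 'h) \<times> 'h set"

definition conditions ::
  "('a, 'b) monoid_scheme \<Rightarrow> nat \<Rightarrow> ('h, 'c) monoid_scheme \<Rightarrow> ('a, 'h) cond set" where
  "conditions G n H =
     {(\<phi>, E). \<phi> \<in> hom (group_power G n) H \<and> \<phi> \<in> extensional (carrier (group_power G n)) \<and>
              E \<subseteq> carrier H}"

definition satisfies :: "(nat \<Rightarrow> 'a) \<Rightarrow> ('a, 'h) cond \<Rightarrow> bool" where
  "satisfies x c \<longleftrightarrow> fst c x \<in> snd c"

definition satisfies_all :: "(nat \<Rightarrow> 'a) \<Rightarrow> ('a, 'h) cond set \<Rightarrow> bool" where
  "satisfies_all x \<C> \<longleftrightarrow> (\<forall>c\<in>\<C>. satisfies x c)"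

definition internally_approximates ::
  "real \<Rightarrow> 'a set \<Rightarrow> nat \<Rightarrow> ('a, 'h) cond set \<Rightarrow> ('a, 'h) cond set \<Rightarrow> bool" where
  "internally_approximates \<epsilon> S n \<F> \<G> \<longleftrightarrow>
     (\<forall>x\<in>set_power S n. satisfies_all x \<F> \<longrightarrow> satisfies_all x \<G>) \<and>
     real (card {x \<in> set_power S n. satisfies_all x \<G> \<and> \<not> satisfies_all x \<F>})
       \<le> \<epsilon> * real (card (set_power S n))"

end

theory Submission
  imports Defs "HOL-Algebra.FiniteProduct"
begin

text \<open>
  On \<open>S\<^sup>n\<close> a condition says that a product of letters, one for each coordinate, lies in \<open>E\<close>. A family of
  such conditions must be replaced by boundedly many stronger ones at little cost, and two situations allow it.

  The first is a sunflower. Suppose that all words of the family agree with a word \<open>w0\<close> except at few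
  coordinates, and that many of these exceptional sets are disjoint. Then at almost every point the differences
  from \<open>w0\<close> take all their possible values \<open>t\<close>, so the family nearly forces \<open>w0 \<otimes> t \<in> E\<close> for all \<open>t\<close>. This
  is a single condition, it implies the whole family, and it is the reason why the approximating conditions need
  not be taken from the family. If there are not many disjoint exceptional sets, boundedly many coordinates meet
  all of them; fixing the letters there divides the family into boundedly many parts with fewer exceptions.

  The second is equidistribution. Suppose that the words agree with \<open>w0\<close> up to values in a subgroup \<open>N\<close>, and
  that many of them are successively independent: each can be moved through its coset of \<open>N\<close> by local changes
  of the point, called gadgets, that do not affect the earlier ones. Then it is unlikely that all of them avoid
  a forbidden element of the coset, so the family nearly forces the whole coset to lie in \<open>E\<close>. If a word lacks
  gadgets, then away from a bounded set its letters are determined by those of the earlier words modulo a proper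
  subgroup of \<open>N\<close> (\<open>gadgets_or_smaller_coset\<close>). There are boundedly many ways in which this can happen, and
  words for which it happens in the same way agree up to the smaller subgroup and few exceptions.

  Both are treated together. Words that agree with a centre up to values in \<open>N\<close>, outside at most \<open>r\<close>
  exceptional coordinates, are arranged greedily into a ladder. A long ladder gives one condition on the centre
  (\<open>ladder_loss\<close>, \<open>approximable_of_ladder\<close>); a ladder that gets stuck divides the family into boundedly many
  parts with a smaller \<open>N\<close>, or with the same \<open>N\<close> and smaller \<open>r\<close> (\<open>approximable_of_stuck_ladder\<close>). Induction on
  the size of \<open>N\<close> and then on \<open>r\<close> finishes the proof, starting from \<open>N = H\<close> and \<open>r = 0\<close>.
\<close>

section \<open>Values reached from few coordinates\<close>

text \<open>
  In a finite group closure under right multiplication by generators already yields closure under their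
  inverses, so an induction over products of letters never has to divide.
\<close>

lemma (in group) right_mult_closed_contains_generate:
  assumes "finite A" "A \<subseteq> carrier G" "\<one> \<in> A" "D \<subseteq> carrier G"
    and closed: "\<And>v g. v \<in> A \<Longrightarrow> g \<in> D \<Longrightarrow> v \<otimes> g \<in> A"
  shows "generate G D \<subseteq> A"
proof -
  have inv_closed: "v \<otimes> inv g \<in> A" if "v \<in> A" "g \<in> D" for v g
  proof -
    have g: "g \<in> carrier G" using that assms by blast
    \<comment> \<open>Right multiplication by \<open>g\<close> is injective on the finite set \<open>A\<close>, hence onto it.\<close>
    have "inj_on (\<lambda>u. u \<otimes> g) A"
      using g assms(2) by (intro inj_onI) (metis right_cancel subsetD)
    moreover have "(\<lambda>u. u \<otimes> g) ` A \<subseteq> A" using closed that by auto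
    ultimately have "(\<lambda>u. u \<otimes> g) ` A = A"
      using endo_inj_surj[OF \<open>finite A\<close>] by blast
    then have "v \<in> (\<lambda>u. u \<otimes> g) ` A" using that(1) by simp
    then obtain u where u: "u \<in> A" "v = u \<otimes> g" by (rule imageE)
    have "u \<in> carrier G" using u(1) assms(2) by (rule subsetD[rotated])
    then have "v \<otimes> inv g = u" using g u(2) by (simp add: m_assoc)
    with u show ?thesis by simp
  qed
  have gc: "generate G D \<subseteq> carrier G" using assms(4) by (rule generate_incl)
  have "\<forall>v\<in>A. v \<otimes> x \<in> A" if "x \<in> generate G D" for x
    using that
  proof induction
    case one then show ?case using assms(2) by auto
  next
    case (incl h) then show ?case using closed by blast
  next
    case (inv h) then show ?case using inv_closed by blast
  next
    case (eng h1 h2)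
    then show ?case using gc assms(2) by (metis (no_types, lifting) m_assoc subsetD)
  qed
  then show ?thesis using assms(3) gc by force
qed

definition (in comm_monoid) reach :: "('i \<Rightarrow> 's \<Rightarrow> 'a) \<Rightarrow> 's set \<Rightarrow> 'i set \<Rightarrow> 'a set" where
  "reach w S I = (\<lambda>y. \<Otimes>i\<in>I. w i (y i)) ` (I \<rightarrow> S)"

context comm_group
begin

lemma reach_subset_carrier:
  assumes "\<And>i s. i \<in> I \<Longrightarrow> s \<in> S \<Longrightarrow> w i s \<in> carrier G"
  shows "reach w S I \<subseteq> carrier G"
  using assms by (auto simp: reach_def Pi_def intro!: finprod_closed)

lemma reach_insert:
  assumes w: "\<And>i s. i \<in> insert k I \<Longrightarrow> s \<in> S \<Longrightarrow> w i s \<in> carrier G"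
    and "finite I" "k \<notin> I" "v \<in> reach w S I" "s \<in> S"
  shows "v \<otimes> w k s \<in> reach w S (insert k I)"
proof -
  obtain y where y: "y \<in> I \<rightarrow> S" "v = (\<Otimes>i\<in>I. w i (y i))"
    using assms(4) by (auto simp: reach_def)
  have c: "(\<lambda>i. w i (y i)) \<in> I \<rightarrow> carrier G" using y(1) w by (auto simp: Pi_def)
  have ks: "w k s \<in> carrier G" using w assms(5) by blast
  have cong: "(\<Otimes>i\<in>I. w i ((y(k:=s)) i)) = v"
    unfolding y(2) using assms(3) c by (intro finprod_cong') auto
  have c': "(\<lambda>i. w i ((y(k:=s)) i)) \<in> I \<rightarrow> carrier G" using c assms(3) by (auto simp: Pi_def)
  have "(\<Otimes>i\<in>insert k I. w i ((y(k:=s)) i)) = w k s \<otimes> v"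
    using finprod_insert[OF assms(2,3) c'] ks cong by simp
  also have "\<dots> = v \<otimes> w k s"
    using ks finprod_closed[OF c] y(2) by (simp add: m_comm)
  finally show ?thesis
    unfolding reach_def using y(1) assms(5) by (intro image_eqI[where x="y(k:=s)"]) auto
qed

text \<open>
  A set reached from few coordinates either already contains the group generated by the remaining
  letters or is enlarged by one more coordinate; it cannot grow more often than the group has elements.
\<close>

lemma generate_subset_reach:
  fixes w :: "'i \<Rightarrow> 's \<Rightarrow> 'a"
  assumes fin: "finite (carrier G)" and s0: "s0 \<in> S"
    and w: "\<And>i s. i \<in> C \<Longrightarrow> s \<in> S \<Longrightarrow> w i s \<in> carrier G"
    and w0: "\<And>i. i \<in> C \<Longrightarrow> w i s0 = \<one>"
    and gen: "\<And>I. finite I \<Longrightarrow> card I \<le> order G \<Longrightarrow> L \<subseteq> generate G {w i s |i s. i \<in> C - I \<and> s \<in> S}"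
  shows "\<exists>I\<subseteq>C. finite I \<and> card I \<le> order G \<and> L \<subseteq> reach w S I"
proof (rule ccontr)
  assume none: "\<not> ?thesis"
  have "\<exists>I\<subseteq>C. finite I \<and> card I = k \<and> k + 1 \<le> card (reach w S I)" if "k \<le> order G" for k
    using that
  proof (induction k)
    case 0
    show ?case by (intro exI[of _ "{}"]) (simp add: reach_def)
  next
    case (Suc k)
    then obtain I where I: "I \<subseteq> C" "finite I" "card I = k" "k + 1 \<le> card (reach w S I)" by auto
    let ?D = "{w i s |i s. i \<in> C - I \<and> s \<in> S}"
    have rc: "reach w S I \<subseteq> carrier G" using I(1) w by (intro reach_subset_carrier) blast
    have finr: "finite (reach w S I)" using rc fin finite_subset by blast
    \<comment> \<open>The base point \<open>s0\<close> contributes nothing, so it may be put at unused coordinates.\<close>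
    have one: "\<one> \<in> reach w S I"
      unfolding reach_def using I(1) w0 s0
      by (intro image_eqI[where x="\<lambda>_. s0"]) (auto intro!: finprod_one_eqI[symmetric])
    have "\<not> generate G ?D \<subseteq> reach w S I"
    proof -
      have "card I \<le> order G" using I(3) Suc.prems by simp
      then have "L \<subseteq> generate G ?D" "\<not> L \<subseteq> reach w S I" using none I(1,2) gen[of I] by blast+
      then show ?thesis by blast
    qed
    moreover have "?D \<subseteq> carrier G" using w by blast
    ultimately obtain v i s where vis: "v \<in> reach w S I" "i \<in> C - I" "s \<in> S" "v \<otimes> w i s \<notin> reach w S I"
      using right_mult_closed_contains_generate[OF finr rc one] by blast
    let ?J = "insert i I"
    have wJ: "w i' s' \<in> carrier G" if "i' \<in> ?J" "s' \<in> S" for i' s' using that w I(1) vis(2) by blast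
    have "u \<in> reach w S ?J" if "u \<in> reach w S I" for u
    proof -
      have "u \<otimes> w i s0 \<in> reach w S ?J"
        using reach_insert[of i I S w, OF wJ I(2) _ that s0] vis(2) by simp
      then show ?thesis using w0 vis(2) that rc by auto
    qed
    moreover have "v \<otimes> w i s \<in> reach w S ?J"
      using reach_insert[of i I S w, OF wJ I(2) _ vis(1,3)] vis(2) by simp
    ultimately have "insert (v \<otimes> w i s) (reach w S I) \<subseteq> reach w S ?J" by blast
    moreover have "finite (reach w S ?J)"
      using reach_subset_carrier[of ?J S w, OF wJ] fin finite_subset by blast
    ultimately have "card (insert (v \<otimes> w i s) (reach w S I)) \<le> card (reach w S ?J)"
      by (rule card_mono[rotated])
    then have "Suc k + 1 \<le> card (reach w S ?J)" using vis(4) finr I(4) by simp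
    then show ?case using I vis(2) by (intro exI[of _ ?J]) auto
  qed
  from this[of "order G"] obtain I where I: "I \<subseteq> C" "order G + 1 \<le> card (reach w S I)" by auto
  have "reach w S I \<subseteq> carrier G" using I(1) w by (intro reach_subset_carrier) blast
  then have "card (reach w S I) \<le> order G" unfolding order_def using fin by (rule card_mono[rotated])
  with I(2) show False by simp
qed

text \<open>
  Deleting \<open>q\<close> coordinates at a time can shrink the group generated by the remaining letters only a
  bounded number of times, since the group is finite. So deleting coordinates until no further deletion of
  \<open>q\<close> of them has an effect stops early.
\<close>

lemma robust_generate:
  fixes w :: "'i \<Rightarrow> 's \<Rightarrow> 'a"
  assumes fin: "finite (carrier G)"
    and w: "\<And>i s. i \<in> C \<Longrightarrow> s \<in> S \<Longrightarrow> w i s \<in> carrier G"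
  shows "\<exists>Z\<subseteq>C. finite Z \<and> card Z \<le> order G * q \<and>
           (\<forall>Y. finite Y \<longrightarrow> card Y \<le> q \<longrightarrow>
              generate G {w i s |i s. i \<in> C - Z \<and> s \<in> S}
                \<subseteq> generate G {w i s |i s. i \<in> C - Z - Y \<and> s \<in> S})"
proof (rule ccontr)
  let ?gen = "\<lambda>Z. generate G {w i s |i s. i \<in> C - Z \<and> s \<in> S}"
  assume none: "\<not> ?thesis"
  have genc: "?gen Z \<subseteq> carrier G" for Z using w by (intro generate_incl) blast
  then have fing: "finite (?gen Z)" for Z using fin finite_subset by blast
  have "\<exists>Z\<subseteq>C. finite Z \<and> card Z \<le> k * q \<and> card (?gen Z) + k \<le> order G" if "k \<le> order G" for k
    using that
  proof (induction k)
    case 0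
    have "card (?gen {}) \<le> order G" unfolding order_def by (rule card_mono[OF fin genc])
    then show ?case by (intro exI[of _ "{}"]) simp
  next
    case (Suc k)
    then obtain Z where Z: "Z \<subseteq> C" "finite Z" "card Z \<le> k * q" "card (?gen Z) + k \<le> order G" by auto
    have "k * q \<le> order G * q" using Suc.prems by simp
    then have "card Z \<le> order G * q" using Z(3) by linarith
    have "\<not> (\<forall>Y. finite Y \<longrightarrow> card Y \<le> q \<longrightarrow>
              ?gen Z \<subseteq> generate G {w i s |i s. i \<in> C - Z - Y \<and> s \<in> S})"
      using none[unfolded not_ex, THEN spec, of Z] Z(1,2) \<open>card Z \<le> order G * q\<close> by (simp only: simp_thms)
    then obtain Y where Y: "finite Y" "card Y \<le> q"
      "\<not> ?gen Z \<subseteq> generate G {w i s |i s. i \<in> C - Z - Y \<and> s \<in> S}"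
      by auto
    let ?Z = "Z \<union> (Y \<inter> C)"
    have eq: "C - ?Z = C - Z - Y" by blast
    have "?gen ?Z \<subseteq> ?gen Z" using w by (intro mono_generate) blast
    then have "?gen ?Z \<subset> ?gen Z" using Y(3) unfolding eq by blast
    then have "card (?gen ?Z) < card (?gen Z)" using fing by (intro psubset_card_mono)
    moreover have "card ?Z \<le> Suc k * q"
    proof -
      have "card ?Z \<le> card Z + card (Y \<inter> C)" by (rule card_Un_le)
      moreover have "card (Y \<inter> C) \<le> q" using Y(1,2) by (meson card_mono inf_le1 order_trans)
      ultimately show ?thesis using Z(3) by simp
    qed
    ultimately show ?case using Z Y(1) by (intro exI[of _ ?Z]) auto
  qed
  from this[of "order G"] obtain Z where "card (?gen Z) = 0" by auto
  then have "?gen Z = {}" using fing by simp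
  then show False using generate.one by blast
qed

text \<open>
  The letters outside a bounded set \<open>Z\<close> lie in a subgroup \<open>L\<close>, each element of which can still be
  realised on boundedly many coordinates, even after a further bounded set \<open>Y\<close> has been forbidden. The bound
  \<open>b + m * order G\<close> leaves room for \<open>Y\<close> and for \<open>m\<close> disjoint realisations chosen one after the other.
\<close>

lemma robust_reach:
  fixes w :: "'i \<Rightarrow> 's \<Rightarrow> 'a"
  assumes fin: "finite (carrier G)" and s0: "s0 \<in> S"
    and w: "\<And>i s. i \<in> C \<Longrightarrow> s \<in> S \<Longrightarrow> w i s \<in> carrier G"
    and w0: "\<And>i. i \<in> C \<Longrightarrow> w i s0 = \<one>"
  shows "\<exists>Z L. Z \<subseteq> C \<and> finite Z \<and> card Z \<le> order G * (b + m * order G) \<and> subgroup L G \<and>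
           (\<forall>i\<in>C - Z. \<forall>s\<in>S. w i s \<in> L) \<and>
           (\<forall>Y. finite Y \<longrightarrow> card Y \<le> b \<longrightarrow>
              (\<exists>I. (\<forall>g<m. I g \<subseteq> C - Y \<and> finite (I g) \<and> card (I g) \<le> order G \<and> L \<subseteq> reach w S (I g)) \<and>
                   (\<forall>g<m. \<forall>g'<m. g \<noteq> g' \<longrightarrow> I g \<inter> I g' = {})))"
proof -
  obtain Z where Z: "Z \<subseteq> C" "finite Z" "card Z \<le> order G * (b + m * order G)"
    and rob: "\<And>Y. finite Y \<Longrightarrow> card Y \<le> b + m * order G \<Longrightarrow>
              generate G {w i s |i s. i \<in> C - Z \<and> s \<in> S}
                \<subseteq> generate G {w i s |i s. i \<in> C - Z - Y \<and> s \<in> S}"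
    using robust_generate[of C S w "b + m * order G", OF fin w] by blast
  define L where "L = generate G {w i s |i s. i \<in> C - Z \<and> s \<in> S}"
  have "{w i s |i s. i \<in> C - Z \<and> s \<in> S} \<subseteq> carrier G" using w by blast
  then have L: "subgroup L G" unfolding L_def by (rule generate_is_subgroup)
  have wL: "\<forall>i\<in>C - Z. \<forall>s\<in>S. w i s \<in> L" unfolding L_def by (auto intro: generate.incl)
  have "\<exists>I. (\<forall>g<k. I g \<subseteq> C - Y \<and> finite (I g) \<and> card (I g) \<le> order G \<and> L \<subseteq> reach w S (I g)) \<and>
            (\<forall>g<k. \<forall>g'<k. g \<noteq> g' \<longrightarrow> I g \<inter> I g' = {})"
    if Y: "finite Y" "card Y \<le> b" and "k \<le> m" for Y k
    using that(3)
  proof (induction k)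
    case 0 show ?case by simp
  next
    case (Suc k)
    then obtain I where I: "\<forall>g<k. I g \<subseteq> C - Y \<and> finite (I g) \<and> card (I g) \<le> order G \<and> L \<subseteq> reach w S (I g)"
      and dis: "\<forall>g<k. \<forall>g'<k. g \<noteq> g' \<longrightarrow> I g \<inter> I g' = {}" by auto
    let ?U = "Y \<union> (\<Union>g<k. I g)"
    have "card (\<Union>g<k. I g) \<le> (\<Sum>g<k. card (I g))" by (rule card_UN_le) simp
    also have "\<dots> \<le> (\<Sum>g<k. order G)" using I by (intro sum_mono) auto
    finally have "card (\<Union>g<k. I g) \<le> k * order G" by simp
    then have U: "finite ?U" "card ?U \<le> b + k * order G"
      using Y I card_Un_le[of Y "\<Union>g<k. I g"] by auto
    have "\<exists>J\<subseteq>C - Z - ?U. finite J \<and> card J \<le> order G \<and> L \<subseteq> reach w S J"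
    proof (rule generate_subset_reach[OF fin s0])
      fix J :: "'i set" assume J: "finite J" "card J \<le> order G"
      have "Suc k * order G \<le> m * order G" using Suc.prems by (rule mult_right_mono) simp
      then have "card (?U \<union> J) \<le> b + m * order G" using card_Un_le[of ?U J] U J by simp
      then have "L \<subseteq> generate G {w i s |i s. i \<in> C - Z - (?U \<union> J) \<and> s \<in> S}"
        unfolding L_def using rob[of "?U \<union> J"] U(1) J(1) by blast
      moreover have "C - Z - (?U \<union> J) = C - Z - ?U - J" by blast
      ultimately show "L \<subseteq> generate G {w i s |i s. i \<in> C - Z - ?U - J \<and> s \<in> S}" by simp
    qed (use w w0 in auto)
    then obtain J where J: "J \<subseteq> C - Z - ?U" "finite J" "card J \<le> order G" "L \<subseteq> reach w S J" by blast
    have *: "I g \<inter> J = {}" if "g < k" for g using J(1) that by blast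
    show ?case
      using I dis J * by (intro exI[of _ "I(k := J)"]) (auto simp: less_Suc_eq)
  qed
  then show ?thesis using Z L wL by (intro exI[of _ Z] exI[of _ L]) blast
qed

end

section \<open>Counting points by local changes\<close>

lemma finite_set_power: "finite S \<Longrightarrow> finite (set_power S n)"
  unfolding set_power_def by (simp add: finite_PiE)

lemma override_on_set_power:
  "x \<in> set_power S n \<Longrightarrow> c \<in> I \<rightarrow> S \<Longrightarrow> I \<subseteq> {..<n} \<Longrightarrow> override_on x c I \<in> set_power S n"
  unfolding set_power_def by (auto simp: PiE_iff override_on_def extensional_def Pi_iff)

text \<open>
  All counting below is done by moving points around: a map that preserves the weight and merges at most
  \<open>K\<close> points transports an upper bound on its target to its source.
\<close>

lemma sum_le_fiber_bound:
  fixes wt :: "'x \<Rightarrow> real"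
  assumes "finite A" "finite B" "f ` A \<subseteq> B"
    and inv: "\<And>x. x \<in> A \<Longrightarrow> wt (f x) = wt x"
    and nonneg: "\<And>y. y \<in> B \<Longrightarrow> 0 \<le> wt y"
    and fib: "\<And>y. y \<in> B \<Longrightarrow> card {x \<in> A. f x = y} \<le> K"
  shows "sum wt A \<le> real K * sum wt B"
proof -
  have "sum wt A = (\<Sum>y\<in>B. sum wt {x \<in> A. f x = y})"
    using sum.group[OF assms(1-3), of wt] by simp
  also have "\<dots> = (\<Sum>y\<in>B. real (card {x \<in> A. f x = y}) * wt y)"
  proof (rule sum.cong)
    fix y assume "y \<in> B"
    have "sum wt {x \<in> A. f x = y} = (\<Sum>x\<in>{x \<in> A. f x = y}. wt y)"
      using inv by (intro sum.cong) auto
    then show "sum wt {x \<in> A. f x = y} = real (card {x \<in> A. f x = y}) * wt y" by simp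
  qed simp
  also have "\<dots> \<le> (\<Sum>y\<in>B. real K * wt y)"
    using fib nonneg by (intro sum_mono mult_right_mono) auto
  finally show ?thesis by (simp add: sum_distrib_left)
qed

lemma card_override_fiber:
  assumes "finite S" "finite I" "I \<subseteq> {..<n}"
  shows "card {x \<in> set_power S n. override_on x c I = y} \<le> card S ^ card I"
proof -
  let ?F = "{x \<in> set_power S n. override_on x c I = y}"
  have inj: "inj_on (\<lambda>x. restrict x I) ?F"
  proof (rule inj_onI, rule ext)
    fix x x' i assume a: "x \<in> ?F" "x' \<in> ?F" "restrict x I = restrict x' I"
    show "x i = x' i"
    proof (cases "i \<in> I")
      case True then show ?thesis using fun_cong[OF a(3), of i] by simp
    next
      case False
      have "override_on x c I = override_on x' c I" using a by simp
      then have "override_on x c I i = override_on x' c I i" by simp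
      then show ?thesis using False by simp
    qed
  qed
  have im: "(\<lambda>x. restrict x I) ` ?F \<subseteq> I \<rightarrow>\<^sub>E S"
    using assms(3) by (auto simp: set_power_def)
  have fin: "finite (I \<rightarrow>\<^sub>E S)" using assms(1,2) by (simp add: finite_PiE)
  have "card ?F \<le> card (I \<rightarrow>\<^sub>E S)" by (rule card_inj_on_le[OF inj im fin])
  then show ?thesis using assms(2) by (simp add: card_PiE)
qed

text \<open>
  Factors that look at disjoint coordinate sets are independent; each one has mean at most
  \<open>1 - a / \<sigma>\<^sup>r\<close>, where \<open>\<sigma>\<close> is the number of elements of \<open>S\<close>, because it
  is at most \<open>1 - a\<close> on one of the at most \<open>\<sigma>\<^sup>r\<close> configurations of its coordinates.
\<close>

lemma sum_prod_disjoint_supports: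
  fixes F :: "'j \<Rightarrow> (nat \<Rightarrow> 'a) \<Rightarrow> real"
  assumes S: "finite S" "S \<noteq> {}" and a: "0 \<le> a" "a \<le> 1" and "finite J"
    and X: "\<And>j. j \<in> J \<Longrightarrow> X j \<subseteq> {..<n} \<and> card (X j) \<le> r"
    and dis: "\<And>j k. j \<in> J \<Longrightarrow> k \<in> J \<Longrightarrow> j \<noteq> k \<Longrightarrow> X j \<inter> X k = {}"
    and c: "\<And>j. j \<in> J \<Longrightarrow> c j \<in> X j \<rightarrow> S"
    and F01: "\<And>j x. j \<in> J \<Longrightarrow> 0 \<le> F j x \<and> F j x \<le> 1"
    and local: "\<And>j x x'. j \<in> J \<Longrightarrow> (\<And>i. i \<in> X j \<Longrightarrow> x i = x' i) \<Longrightarrow> F j x = F j x'"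
    and low: "\<And>j x. j \<in> J \<Longrightarrow> (\<And>i. i \<in> X j \<Longrightarrow> x i = c j i) \<Longrightarrow> F j x \<le> 1 - a"
  shows "(\<Sum>x\<in>set_power S n. \<Prod>j\<in>J. F j x)
           \<le> real (card (set_power S n)) * (1 - a / real (card S) ^ r) ^ card J"
  using \<open>finite J\<close> X dis c F01 local low
proof (induction J)
  case empty show ?case by simp
next
  case (insert k J)
  let ?O = "set_power S n" and ?\<sigma> = "real (card S)"
  have \<sigma>: "1 \<le> ?\<sigma>" using S by (simp add: Suc_le_eq card_gt_0_iff)
  define W where "W x = (\<Prod>j\<in>J. F j x)" for x
  define B where "B = {x \<in> ?O. \<forall>i\<in>X k. x i = c k i}"
  have W0: "0 \<le> W x" for x unfolding W_def using insert.prems(4) by (intro prod_nonneg) auto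
  have Xk: "X k \<subseteq> {..<n}" "card (X k) \<le> r" "finite (X k)"
    using insert.prems(1)[of k] finite_subset[of "X k" "{..<n}"] by auto
  have finO: "finite ?O" using S(1) by (rule finite_set_power)
  have "sum W ?O \<le> real (card S ^ r) * sum W B"
  proof (rule sum_le_fiber_bound[where f="\<lambda>x. override_on x (c k) (X k)"])
    show "(\<lambda>x. override_on x (c k) (X k)) ` ?O \<subseteq> B"
      unfolding B_def using override_on_set_power insert.prems(3)[of k] Xk by auto
    show "W (override_on x (c k) (X k)) = W x" for x
      unfolding W_def
    proof (rule prod.cong)
      fix j assume j: "j \<in> J"
      then have "X j \<inter> X k = {}" using insert.prems(2)[of j k] insert.hyps by auto
      then show "F j (override_on x (c k) (X k)) = F j x"
        using j by (intro insert.prems(5)) (auto simp: override_on_def)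
    qed simp
    show "card {x \<in> ?O. override_on x (c k) (X k) = y} \<le> card S ^ r" for y
    proof -
      have "card {x \<in> ?O. override_on x (c k) (X k) = y} \<le> card S ^ card (X k)"
        using S(1) Xk by (intro card_override_fiber)
      also have "\<dots> \<le> card S ^ r" using Xk(2) \<sigma> by (intro power_increasing) auto
      finally show ?thesis .
    qed
  qed (use finO W0 in \<open>auto simp: B_def\<close>)
  then have B: "sum W ?O / ?\<sigma> ^ r \<le> sum W B" using \<sigma> by (simp add: field_simps)
  have "(\<Sum>x\<in>?O. \<Prod>j\<in>insert k J. F j x) = (\<Sum>x\<in>?O. F k x * W x)"
    unfolding W_def using insert.hyps by simp
  also have "\<dots> \<le> (\<Sum>x\<in>?O. W x - (if x \<in> B then a * W x else 0))"
  proof (rule sum_mono)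
    fix x assume "x \<in> ?O"
    show "F k x * W x \<le> W x - (if x \<in> B then a * W x else 0)"
    proof (cases "x \<in> B")
      case True
      then have "F k x \<le> 1 - a" using insert.prems(6)[of k x] by (auto simp: B_def)
      then have "F k x * W x \<le> (1 - a) * W x" using W0 by (rule mult_right_mono)
      then show ?thesis using True by (simp add: algebra_simps)
    next
      case False
      then show ?thesis using insert.prems(4)[of k x] W0[of x] mult_right_mono[of "F k x" 1 "W x"] by auto
    qed
  qed
  also have "\<dots> = sum W ?O - a * sum W B"
  proof -
    have "(\<Sum>x\<in>?O. if x \<in> B then a * W x else 0) = (\<Sum>x\<in>B. a * W x)"
      using finO by (subst sum.inter_restrict[symmetric]) (auto simp: B_def intro!: sum.cong)
    then show ?thesis by (simp add: sum_subtractf sum_distrib_left)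
  qed
  also have "\<dots> \<le> sum W ?O - a * (sum W ?O / ?\<sigma> ^ r)"
    using mult_left_mono[OF B a(1)] by linarith
  also have "\<dots> = (1 - a / ?\<sigma> ^ r) * sum W ?O" by (simp add: algebra_simps)
  also have "\<dots> \<le> (1 - a / ?\<sigma> ^ r) * (real (card ?O) * (1 - a / ?\<sigma> ^ r) ^ card J)"
  proof (rule mult_left_mono)
    show "sum W ?O \<le> real (card ?O) * (1 - a / ?\<sigma> ^ r) ^ card J"
      unfolding W_def
    proof (rule insert.IH)
      show "X j \<subseteq> {..<n} \<and> card (X j) \<le> r" if "j \<in> J" for j
        using insert.prems(1)[of j] that by simp
      show "X j \<inter> X j' = {}" if "j \<in> J" "j' \<in> J" "j \<noteq> j'" for j j'
        using insert.prems(2)[of j j'] that by simp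
      show "c j \<in> X j \<rightarrow> S" if "j \<in> J" for j
        using insert.prems(3)[of j] that by simp
      show "0 \<le> F j x \<and> F j x \<le> 1" if "j \<in> J" for j x
        using insert.prems(4)[of j x] that by simp
      show "F j x = F j x'" if "j \<in> J" "\<And>i. i \<in> X j \<Longrightarrow> x i = x' i" for j x x'
        by (rule insert.prems(5)) (use that in simp_all)
      show "F j x \<le> 1 - a" if "j \<in> J" "\<And>i. i \<in> X j \<Longrightarrow> x i = c j i" for j x
        by (rule insert.prems(6)) (use that in simp_all)
    qed
    have "a \<le> ?\<sigma> ^ r" using a(2) one_le_power[OF \<sigma>, of r] by linarith
    then show "0 \<le> 1 - a / ?\<sigma> ^ r" using \<sigma> by (simp add: field_simps)
  qed
  finally show ?case using insert.hyps by (simp add: mult_ac)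
qed

text \<open>
  The sets \<open>I g\<close> are disjoint and carry configurations \<open>c g h\<close> indexed by \<open>N\<close>. Call a point active at \<open>g\<close> if
  it shows one of them. A suitable change of configuration at the first \<open>g\<close> where \<open>x\<close> is active sends \<open>x\<close> to a
  failing point; disjointness keeps \<open>g\<close> the first one, so the old configuration is all that is forgotten, and at
  most \<open>\<eta>\<close> points share an image. So failing points make up at least a fraction \<open>1 / (\<eta> + 1)\<close> of the active
  ones, and inactive points are rare.
\<close>

lemma gadgets_force_failures:
  fixes wt :: "(nat \<Rightarrow> 'a) \<Rightarrow> real" and fails :: "(nat \<Rightarrow> 'a) \<Rightarrow> bool" and m :: nat
  assumes S: "finite S" "S \<noteq> {}" and CO: "C \<subseteq> set_power S n"
    and N: "finite N" "N \<noteq> {}" "card N \<le> \<eta>"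
    and I: "\<And>g. g < m \<Longrightarrow> I g \<subseteq> {..<n} \<and> card (I g) \<le> q"
    and dis: "\<And>g g'. g < m \<Longrightarrow> g' < m \<Longrightarrow> g \<noteq> g' \<Longrightarrow> I g \<inter> I g' = {}"
    and c: "\<And>g h. g < m \<Longrightarrow> h \<in> N \<Longrightarrow> c g h \<in> I g \<rightarrow> S"
    and wt01: "\<And>x. 0 \<le> wt x \<and> wt x \<le> 1"
    and wt_inv: "\<And>x g h. g < m \<Longrightarrow> h \<in> N \<Longrightarrow> wt (override_on x (c g h) (I g)) = wt x"
    and C_inv: "\<And>x g h h'. x \<in> C \<Longrightarrow> g < m \<Longrightarrow> h \<in> N \<Longrightarrow> h' \<in> N \<Longrightarrow>
        (\<And>i. i \<in> I g \<Longrightarrow> x i = c g h' i) \<Longrightarrow> override_on x (c g h) (I g) \<in> C"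
    and fail: "\<And>x g h'. x \<in> C \<Longrightarrow> g < m \<Longrightarrow> h' \<in> N \<Longrightarrow>
        (\<And>i. i \<in> I g \<Longrightarrow> x i = c g h' i) \<Longrightarrow> \<exists>h\<in>N. fails (override_on x (c g h) (I g))"
  shows "sum wt {x \<in> C. \<not> fails x}
           \<le> real \<eta> / (real \<eta> + 1) * sum wt C + real (card (set_power S n)) * (1 - 1 / real (card S) ^ q) ^ m"
proof -
  define act where "act x g \<longleftrightarrow> g < m \<and> (\<exists>h\<in>N. \<forall>i\<in>I g. x i = c g h i)" for x g
  define fst_act where "fst_act x = (LEAST g. act x g)" for x
  define A where "A = {x \<in> C. \<not> fails x \<and> (\<exists>g. act x g)}"
  define B where "B = {x \<in> C. fails x}"
  define D where "D = {x \<in> C. \<not> fails x \<and> \<not> (\<exists>g. act x g)}"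
  have finO: "finite (set_power S n)" using S(1) by (rule finite_set_power)
  have finC: "finite C" using CO finO finite_subset by blast
  have finAB: "finite A" "finite B" unfolding A_def B_def using finC by simp_all
  have fa: "act x (fst_act x)" if "x \<in> A" for x
    using that unfolding A_def fst_act_def by (auto intro: LeastI)
  have "\<exists>h\<in>N. fails (override_on x (c (fst_act x) h) (I (fst_act x)))" if "x \<in> A" for x
    using fa[OF that] that fail[of x "fst_act x"] unfolding act_def A_def by blast
  then obtain hh where hh: "\<And>x. x \<in> A \<Longrightarrow> hh x \<in> N \<and> fails (override_on x (c (fst_act x) (hh x)) (I (fst_act x)))"
    by metis
  define f where "f x = override_on x (c (fst_act x) (hh x)) (I (fst_act x))" for x
  have fB: "f x \<in> B" if "x \<in> A" for x
    using fa[OF that] that hh[OF that] C_inv[of x "fst_act x" "hh x"]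
    unfolding act_def A_def B_def f_def by blast
  have fst_f: "fst_act (f x) = fst_act x" if x: "x \<in> A" for x
  proof -
    have "act (f x) (fst_act x)"
      using fa[OF x] hh[OF x] unfolding act_def f_def by auto
    moreover have "\<not> act (f x) g" if "g < fst_act x" for g
    proof
      assume ag: "act (f x) g"
      then have "I g \<inter> I (fst_act x) = {}" using dis[of g "fst_act x"] fa[OF x] that by (auto simp: act_def)
      then have "\<forall>i\<in>I g. f x i = x i" by (auto simp: f_def override_on_def)
      then have "act x g" using ag by (auto simp: act_def)
      then show False using that not_less_Least unfolding fst_act_def by blast
    qed
    ultimately show ?thesis
      unfolding fst_act_def[of "f x"] by (intro Least_equality) (auto simp: not_less[symmetric])
  qed
  have "sum wt A \<le> real \<eta> * sum wt B"
  proof (rule sum_le_fiber_bound[where f=f])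
    show "f ` A \<subseteq> B" using fB by blast
    show "wt (f x) = wt x" if "x \<in> A" for x
      unfolding f_def using fa[OF that] hh[OF that] by (intro wt_inv) (auto simp: act_def)
    show "card {x \<in> A. f x = y} \<le> \<eta>" for y
    proof -
      have "{x \<in> A. f x = y} \<subseteq> (\<lambda>h. override_on y (c (fst_act y) h) (I (fst_act y))) ` N"
      proof
        fix x assume "x \<in> {x \<in> A. f x = y}"
        then have x: "x \<in> A" "f x = y" by auto
        obtain h where h: "h \<in> N" "\<forall>i\<in>I (fst_act x). x i = c (fst_act x) h i"
          using fa[OF x(1)] by (auto simp: act_def)
        have "x = override_on (f x) (c (fst_act x) h) (I (fst_act x))"
          using h(2) by (auto simp: f_def override_on_def)
        then show "x \<in> (\<lambda>h. override_on y (c (fst_act y) h) (I (fst_act y))) ` N"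
          using h(1) fst_f[OF x(1)] x(2) by auto
      qed
      then have "card {x \<in> A. f x = y} \<le> card N" using N(1) by (rule surj_card_le[rotated])
      then show ?thesis using N(3) by simp
    qed
  qed (use finAB wt01 in auto)
  then have "(real \<eta> + 1) * sum wt A \<le> real \<eta> * (sum wt A + sum wt B)"
    by (simp add: algebra_simps)
  then have AB: "sum wt A \<le> real \<eta> / (real \<eta> + 1) * (sum wt A + sum wt B)"
    by (simp add: pos_le_divide_eq mult.commute)
  have "sum wt A + sum wt B \<le> sum wt C"
  proof -
    have "sum wt A + sum wt B = sum wt (A \<union> B)"
      using finC by (intro sum.union_disjoint[symmetric]) (auto simp: A_def B_def)
    also have "\<dots> \<le> sum wt C"
      using finC wt01 by (intro sum_mono2) (auto simp: A_def B_def)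
    finally show ?thesis .
  qed
  then have "real \<eta> / (real \<eta> + 1) * (sum wt A + sum wt B) \<le> real \<eta> / (real \<eta> + 1) * sum wt C"
    by (rule mult_left_mono) simp
  with AB have A: "sum wt A \<le> real \<eta> / (real \<eta> + 1) * sum wt C" by linarith
  obtain h0 where h0: "h0 \<in> N" using N(2) by blast
  define F where "F g x = (if \<exists>h\<in>N. \<forall>i\<in>I g. x i = c g h i then 0 else 1 :: real)" for g x
  have "sum wt D \<le> (\<Sum>x\<in>D. \<Prod>g\<in>{..<m}. F g x)"
  proof (rule sum_mono)
    fix x assume "x \<in> D"
    then have "\<forall>g<m. F g x = 1" by (auto simp: D_def act_def F_def)
    then show "wt x \<le> (\<Prod>g\<in>{..<m}. F g x)" using wt01[of x] by simp
  qed
  also have "\<dots> \<le> (\<Sum>x\<in>set_power S n. \<Prod>g\<in>{..<m}. F g x)"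
    using finO CO by (intro sum_mono2) (auto simp: D_def F_def intro!: prod_nonneg)
  also have "\<dots> \<le> real (card (set_power S n)) * (1 - 1 / real (card S) ^ q) ^ card {..<m}"
  proof (rule sum_prod_disjoint_supports[where X=I and c="\<lambda>g. c g h0"])
    show "F g x = F g x'" if "\<And>i. i \<in> I g \<Longrightarrow> x i = x' i" for g x x'
      using that by (simp add: F_def)
    show "F g x \<le> 1 - 1" if "\<And>i. i \<in> I g \<Longrightarrow> x i = c g h0 i" for g x
      using that h0 by (auto simp: F_def)
  qed (use S I dis c h0 in \<open>auto simp: F_def\<close>)
  finally have D: "sum wt D \<le> real (card (set_power S n)) * (1 - 1 / real (card S) ^ q) ^ m" by simp
  have "{x \<in> C. \<not> fails x} = A \<union> D" by (auto simp: A_def D_def)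
  also have "sum wt (A \<union> D) = sum wt A + sum wt D"
    using finC by (intro sum.union_disjoint) (auto simp: A_def D_def)
  finally show ?thesis using A D by linarith
qed

section \<open>Words and ladders\<close>

text \<open>
  The setting is stripped of the group \<open>G\<close>: a letter is the function \<open>s \<mapsto> f s \<otimes> inv (f s0)\<close> on \<open>S\<close>
  belonging to a homomorphism \<open>f\<close>, but only its values matter. Normalising at a base point \<open>s0\<close> removes a
  constant from every condition, which merely translates the set \<open>E\<close>, and lets a coordinate be switched off
  by setting it to \<open>s0\<close>.
\<close>

locale letter_system = comm_group H for H :: "('h, 'c) monoid_scheme" (structure) +
  fixes S :: "'s set" and s0 :: 's and M :: "('s \<Rightarrow> 'h) set"
  assumes finite_H: "finite (carrier H)"
    and finite_S: "finite S" and s0: "s0 \<in> S"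
    and finite_M: "finite M"
    and M_closed: "\<And>\<mu> s. \<mu> \<in> M \<Longrightarrow> s \<in> S \<Longrightarrow> \<mu> s \<in> carrier H"
    and M_base: "\<And>\<mu>. \<mu> \<in> M \<Longrightarrow> \<mu> s0 = \<one>"
begin

text \<open>
  Only the letters below \<open>n\<close> are ever read, so words are not required to be extensional and can be patched
  with \<^const>\<open>override_on\<close>.
\<close>

definition words :: "nat \<Rightarrow> (nat \<Rightarrow> 's \<Rightarrow> 'h) set" where
  "words n = {w. \<forall>i<n. w i \<in> M}"

definition part :: "(nat \<Rightarrow> 's \<Rightarrow> 'h) \<Rightarrow> nat set \<Rightarrow> (nat \<Rightarrow> 's) \<Rightarrow> 'h" where
  "part w I x = finprod H (\<lambda>i. w i (x i)) I"

definition quot :: "(nat \<Rightarrow> 's \<Rightarrow> 'h) \<Rightarrow> (nat \<Rightarrow> 's \<Rightarrow> 'h) \<Rightarrow> nat \<Rightarrow> 's \<Rightarrow> 'h" where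
  "quot w w' i s = w' i s \<otimes> inv (w i s)"

definition exceptional :: "nat \<Rightarrow> 'h set \<Rightarrow> (nat \<Rightarrow> 's \<Rightarrow> 'h) \<Rightarrow> (nat \<Rightarrow> 's \<Rightarrow> 'h) \<Rightarrow> nat set" where
  "exceptional n N w w' = {i. i < n \<and> (\<exists>s\<in>S. quot w w' i s \<notin> N)}"

text \<open>
  Switching a point from one configuration \<open>c h\<close> to another on \<open>I\<close> moves the value of \<open>w l\<close> through a coset
  of \<open>N\<close> and leaves the values of the earlier words unchanged.
\<close>

definition gadget ::
  "'h set \<Rightarrow> (nat \<Rightarrow> nat \<Rightarrow> 's \<Rightarrow> 'h) \<Rightarrow> nat \<Rightarrow> nat set \<Rightarrow> ('h \<Rightarrow> nat \<Rightarrow> 's) \<Rightarrow> bool" where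
  "gadget N w l I c \<longleftrightarrow>
     (\<forall>h\<in>N. c h \<in> I \<rightarrow> S \<and> (\<forall>a<l. part (w a) I (c h) = \<one>) \<and> part (w l) I (c h) = h)"

lemma words_closed: "w \<in> words n \<Longrightarrow> i < n \<Longrightarrow> s \<in> S \<Longrightarrow> w i s \<in> carrier H"
  by (auto simp: words_def M_closed)

lemma quot_closed:
  "w \<in> words n \<Longrightarrow> w' \<in> words n \<Longrightarrow> i < n \<Longrightarrow> s \<in> S \<Longrightarrow> quot w w' i s \<in> carrier H"
  unfolding quot_def by (intro m_closed inv_closed words_closed)

lemma set_powerD: "x \<in> set_power S n \<Longrightarrow> i < n \<Longrightarrow> x i \<in> S"
  by (auto simp: set_power_def)

lemma part_closed:
  "(\<And>i. i \<in> I \<Longrightarrow> w i (x i) \<in> carrier H) \<Longrightarrow> part w I x \<in> carrier H"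
  unfolding part_def by (intro finprod_closed) auto

lemma part_cong:
  assumes "\<And>i. i \<in> I \<Longrightarrow> x i = y i" "\<And>i. i \<in> I \<Longrightarrow> w i (y i) \<in> carrier H"
  shows "part w I x = part w I y"
  unfolding part_def using assms by (intro finprod_cong') auto

lemma part_split:
  assumes "finite J" "I \<subseteq> J" "\<And>i. i \<in> J \<Longrightarrow> w i (x i) \<in> carrier H"
  shows "part w J x = part w I x \<otimes> part w (J - I) x"
proof -
  have "part w (I \<union> (J - I)) x = part w I x \<otimes> part w (J - I) x"
    unfolding part_def using assms finite_subset[OF assms(2,1)]
    by (intro finprod_Un_disjoint) auto
  moreover have "I \<union> (J - I) = J" using assms(2) by blast
  ultimately show ?thesis by simp
qed

lemma part_override:
  assumes w: "w \<in> words n" and x: "x \<in> set_power S n" and I: "I \<subseteq> {..<n}" and c: "c \<in> I \<rightarrow> S"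
  shows "part w {..<n} (override_on x c I) = part w I c \<otimes> part w ({..<n} - I) x"
proof -
  have ov: "override_on x c I \<in> set_power S n" using x c I by (rule override_on_set_power)
  have cl: "\<And>i. i < n \<Longrightarrow> w i (override_on x c I i) \<in> carrier H"
    using words_closed[OF w] set_powerD[OF ov] by blast
  have "part w {..<n} (override_on x c I)
      = part w I (override_on x c I) \<otimes> part w ({..<n} - I) (override_on x c I)"
    using I cl by (intro part_split) auto
  moreover have "part w I (override_on x c I) = part w I c"
    using I c words_closed[OF w] by (intro part_cong) (auto simp: Pi_iff)
  moreover have "part w ({..<n} - I) (override_on x c I) = part w ({..<n} - I) x"
    using words_closed[OF w] set_powerD[OF x] by (intro part_cong) auto
  ultimately show ?thesis by simp
qed

lemma part_in_subgroup:
  assumes N: "subgroup N H" and "finite I" and "\<And>i. i \<in> I \<Longrightarrow> w i (x i) \<in> N"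
  shows "part w I x \<in> N"
  using assms(2,3)
proof (induction I)
  case empty show ?case using subgroup.one_closed[OF N] by (simp add: part_def)
next
  case (insert k I)
  have "(\<lambda>i. w i (x i)) \<in> I \<rightarrow> carrier H" "w k (x k) \<in> carrier H"
    using insert.prems subgroup.subset[OF N] by auto
  then have "part w (insert k I) x = w k (x k) \<otimes> part w I x"
    unfolding part_def using insert.hyps by (intro finprod_insert) auto
  then show ?case using insert subgroup.m_closed[OF N] by auto
qed

lemma part_quot:
  assumes "w \<in> words n" "w' \<in> words n" "x \<in> set_power S n" "I \<subseteq> {..<n}"
  shows "part w' I x = part w I x \<otimes> part (quot w w') I x"
proof -
  have i: "i < n" if "i \<in> I" for i using that assms(4) by blast
  have cl: "w i (x i) \<in> carrier H" "w' i (x i) \<in> carrier H" "quot w w' i (x i) \<in> carrier H" if "i \<in> I" for i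
    using words_closed assms(1,2) quot_closed[OF assms(1,2)] set_powerD[OF assms(3)] i[OF that] by auto
  have "part w I x \<otimes> part (quot w w') I x = finprod H (\<lambda>i. w i (x i) \<otimes> quot w w' i (x i)) I"
    unfolding part_def using cl by (intro finprod_multf[symmetric]) auto
  also have "\<dots> = part w' I x"
    unfolding part_def
  proof (rule finprod_cong')
    fix i assume "i \<in> I"
    from cl[OF this] show "w i (x i) \<otimes> quot w w' i (x i) = w' i (x i)"
      unfolding quot_def by (simp add: m_lcomm[of "w i (x i)"])
  qed (use cl in auto)
  finally show ?thesis by simp
qed

lemma exceptional_subset: "exceptional n N w w' \<subseteq> {..<n}" "finite (exceptional n N w w')"
  unfolding exceptional_def by auto

text \<open>
  All other coordinates contribute quotients in \<open>N\<close>, whose product is the factor \<open>h\<close>.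
\<close>

lemma value_modulo_subgroup:
  assumes N: "subgroup N H" and w: "w \<in> words n" "w' \<in> words n" and x: "x \<in> set_power S n"
  shows "\<exists>h\<in>N. part w' {..<n} x =
           part w {..<n} x \<otimes> part (quot w w') (exceptional n N w w') x \<otimes> h"
proof -
  let ?X = "exceptional n N w w'"
  let ?h = "part (quot w w') ({..<n} - ?X) x"
  have h: "?h \<in> N"
    using set_powerD[OF x] by (intro part_in_subgroup[OF N]) (auto simp: exceptional_def)
  have qc: "quot w w' i (x i) \<in> carrier H" if "i < n" for i
    using quot_closed[OF w that] set_powerD[OF x that] by simp
  have "part w' {..<n} x = part w {..<n} x \<otimes> part (quot w w') {..<n} x"
    using w x by (intro part_quot) auto
  also have "part (quot w w') {..<n} x = part (quot w w') ?X x \<otimes> ?h"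
    using qc exceptional_subset(1)[of n N w w'] by (intro part_split) auto
  finally show ?thesis
    using h qc exceptional_subset(1)[of n N w w'] words_closed[OF w(1)] set_powerD[OF x]
    by (intro bexI[of _ ?h]) (auto simp: m_assoc[symmetric] intro!: part_closed m_assoc[symmetric])
qed

text \<open>
  A ladder is a sequence \<open>w 1, \<dots>, w d\<close> with disjoint exceptional sets relative to \<open>w 0\<close>, each rung having
  \<open>m\<close> disjoint gadgets that avoid all exceptional sets. When the exceptional coordinates of \<open>w l\<close> contribute
  \<open>t\<close>, the value of \<open>w l\<close> lies in the coset of \<open>N\<close> through \<open>w 0 \<otimes> t\<close>, and this coset contains an element
  outside \<open>E\<close>. The gadgets of \<open>w l\<close> move its value around in the coset without disturbing the earlier words
  or any exceptional coordinate, so demanding \<open>w l \<in> E\<close> costs a factor \<open>\<theta> < 1\<close> each time, up to the few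
  points at which no gadget is active. Give a point one factor \<open>\<theta>\<close> for every such event still to come:
  along the ladder the total weight then grows by at most these few points, at the end the weight is constantly
  \<open>1\<close>, and at the start it factorises over the disjoint exceptional sets, which makes it small.
\<close>

lemma ladder_loss:
  fixes w :: "nat \<Rightarrow> nat \<Rightarrow> 's \<Rightarrow> 'h" and n d m q r :: nat and N E :: "'h set" and t :: 'h
    and I :: "nat \<Rightarrow> nat \<Rightarrow> nat set" and c :: "nat \<Rightarrow> nat \<Rightarrow> 'h \<Rightarrow> nat \<Rightarrow> 's"
  defines "X \<equiv> \<lambda>l. exceptional n N (w 0) (w l)"
  assumes N: "subgroup N H"
    and w: "\<And>l. l \<le> d \<Longrightarrow> w l \<in> words n"
    and X_card: "\<And>l. 1 \<le> l \<Longrightarrow> l \<le> d \<Longrightarrow> card (X l) \<le> r"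
    and X_dis: "\<And>l k. 1 \<le> l \<Longrightarrow> l \<le> d \<Longrightarrow> 1 \<le> k \<Longrightarrow> k \<le> d \<Longrightarrow> l \<noteq> k \<Longrightarrow> X l \<inter> X k = {}"
    and I: "\<And>l g. 1 \<le> l \<Longrightarrow> l \<le> d \<Longrightarrow> g < m \<Longrightarrow> I l g \<subseteq> {..<n} \<and> card (I l g) \<le> q"
    and I_dis: "\<And>l g g'. 1 \<le> l \<Longrightarrow> l \<le> d \<Longrightarrow> g < m \<Longrightarrow> g' < m \<Longrightarrow> g \<noteq> g' \<Longrightarrow> I l g \<inter> I l g' = {}"
    and IX_dis: "\<And>l k g. 1 \<le> l \<Longrightarrow> l \<le> d \<Longrightarrow> 1 \<le> k \<Longrightarrow> k \<le> d \<Longrightarrow> g < m \<Longrightarrow> I l g \<inter> X k = {}"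
    and gad: "\<And>l g. 1 \<le> l \<Longrightarrow> l \<le> d \<Longrightarrow> g < m \<Longrightarrow> gadget N w l (I l g) (c l g)"
    and t: "\<And>l. 1 \<le> l \<Longrightarrow> l \<le> d \<Longrightarrow> t \<in> reach (quot (w 0) (w l)) S (X l)"
    and t_carrier: "t \<in> carrier H"
  shows "real (card {x \<in> set_power S n. (\<exists>h\<in>N. part (w 0) {..<n} x \<otimes> t \<otimes> h \<notin> E) \<and>
                       (\<forall>l\<in>{1..d}. part (w l) {..<n} x \<in> E)})
           \<le> real (card (set_power S n)) *
              ((1 - 1 / ((real (order H) + 1) * real (card S) ^ r)) ^ d
               + real d * (1 - 1 / real (card S) ^ q) ^ m)"
proof -
  let ?O = "set_power S n" and ?\<sigma> = "real (card S)"
  define \<theta> where "\<theta> = real (order H) / (real (order H) + 1)"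
  define \<delta> where "\<delta> = real (card ?O) * (1 - 1 / ?\<sigma> ^ q) ^ m"
  have \<theta>: "0 \<le> \<theta>" "\<theta> \<le> 1" unfolding \<theta>_def by auto
  define v where "v l x = part (w l) {..<n} x" for l x
  \<comment> \<open>The restriction makes \<open>hit\<close> depend on the coordinates in \<open>X l\<close> alone even for functions outside \<open>S\<^sup>n\<close>.\<close>
  define hit where "hit l x \<longleftrightarrow> part (quot (w 0) (w l)) (X l) (restrict x (X l)) = t" for l x
  define wt where "wt l x = (\<Prod>j\<in>{l<..d}. if hit j x then \<theta> else 1)" for l x
  define C where "C l = {x \<in> ?O. (\<exists>h\<in>N. v 0 x \<otimes> t \<otimes> h \<notin> E) \<and> (\<forall>j\<in>{1..l}. v j x \<in> E)}" for l
  have finO: "finite ?O" using finite_S by (rule finite_set_power)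
  have finC: "finite (C l)" for l unfolding C_def using finO by simp
  have Ss: "S \<noteq> {}" using s0 by blast
  have finN: "finite N" using N finite_H subgroup.subset finite_subset by blast
  have cardN: "card N \<le> order H"
    unfolding order_def using finite_H N subgroup.subset by (intro card_mono)
  have oneN: "\<one> \<in> N" using N by (rule subgroup.one_closed)
  have wt01: "0 \<le> wt l x \<and> wt l x \<le> 1" for l x
    unfolding wt_def using \<theta> by (auto intro!: prod_nonneg prod_le_1)
  have Xn: "X l \<subseteq> {..<n}" for l unfolding X_def by (rule exceptional_subset)
  have v_closed: "v l x \<in> carrier H" if "l \<le> d" "x \<in> ?O" for l x
    unfolding v_def using words_closed[OF w[OF that(1)]] set_powerD[OF that(2)] by (intro part_closed) auto
  have hit_local: "hit j x = hit j y" if "\<And>i. i \<in> X j \<Longrightarrow> x i = y i" for j x y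
  proof -
    have "restrict x (X j) = restrict y (X j)" using that by (rule restrict_ext)
    then show ?thesis by (simp add: hit_def)
  qed
  have hit_iff: "hit j x \<longleftrightarrow> part (quot (w 0) (w j)) (X j) x = t" if "j \<le> d" "x \<in> ?O" for j x
  proof -
    have "part (quot (w 0) (w j)) (X j) (restrict x (X j)) = part (quot (w 0) (w j)) (X j) x"
      using quot_closed[OF w[of 0] w[OF that(1)]] set_powerD[OF that(2)] Xn[of j]
      by (intro part_cong) auto
    then show ?thesis by (simp add: hit_def)
  qed
  have gadD: "c l g h \<in> I l g \<rightarrow> S" "\<And>a. a < l \<Longrightarrow> part (w a) (I l g) (c l g h) = \<one>"
      "part (w l) (I l g) (c l g h) = h"
    if "1 \<le> l" "l \<le> d" "g < m" "h \<in> N" for l g h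
    using gad[OF that(1-3)] that(4) unfolding gadget_def by auto
  have ov: "override_on x (c l g h) (I l g) \<in> ?O"
    if "1 \<le> l" "l \<le> d" "g < m" "h \<in> N" "x \<in> ?O" for l g h x
    using that(5) gadD(1)[OF that(1-4)] I[OF that(1-3)] by (intro override_on_set_power) auto
  have hit_ov: "hit j (override_on x (c l g h) (I l g)) = hit j x"
    if "1 \<le> l" "l \<le> d" "g < m" "1 \<le> j" "j \<le> d" for j l g h x
  proof (rule hit_local)
    fix i assume "i \<in> X j"
    then have "i \<notin> I l g" using IX_dis[OF that(1,2,4,5,3)] by blast
    then show "override_on x (c l g h) (I l g) i = x i" by simp
  qed
  have v_ov: "v a (override_on x (c l g h) (I l g)) = (if a = l then h else \<one>) \<otimes> part (w a) ({..<n} - I l g) x"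
    if "1 \<le> l" "l \<le> d" "g < m" "h \<in> N" "a \<le> l" "x \<in> ?O" for a l g h x
    unfolding v_def using that gadD[OF that(1-4)] I[OF that(1-3)] w[of a]
    by (subst part_override) auto
  have rest_closed: "part (w a) ({..<n} - J) x \<in> carrier H" if "a \<le> d" "x \<in> ?O" for a J x
    using words_closed[OF w[OF that(1)]] set_powerD[OF that(2)] by (intro part_closed) auto
  have shown: "override_on x (c l g h) (I l g) = x"
    if "\<And>i. i \<in> I l g \<Longrightarrow> x i = c l g h i" for x l g h
    using that by (auto simp: override_on_def)
  have rung: "sum (wt (Suc l)) (C (Suc l)) \<le> sum (wt l) (C l) + \<delta>" if l: "Suc l \<le> d" for l
  proof -
    let ?l = "Suc l"
    define D where "D = {x \<in> C l. hit ?l x}"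
    have DO: "D \<subseteq> ?O" by (auto simp: D_def C_def)
    have l1: "1 \<le> ?l" by simp
    have C_ov: "override_on x (c ?l g h) (I ?l g) \<in> D"
      if x: "x \<in> D" and g: "g < m" and h: "h \<in> N" "h' \<in> N"
        and sh: "\<And>i. i \<in> I ?l g \<Longrightarrow> x i = c ?l g h' i" for x g h h'
    proof -
      have xO: "x \<in> ?O" using x DO by blast
      have "v a (override_on x (c ?l g h) (I ?l g)) = v a x" if "a \<le> l" for a
        using v_ov[OF l1 l g h(1) _ xO, of a] v_ov[OF l1 l g h(2) _ xO, of a] shown[OF sh] that by simp
      then show ?thesis
        using x ov[OF l1 l g h(1) xO] hit_ov[OF l1 l g l1 l] by (auto simp: D_def C_def)
    qed
    have D_fail: "\<exists>h\<in>N. v ?l (override_on x (c ?l g h) (I ?l g)) \<notin> E"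
      if x: "x \<in> D" and g: "g < m" and h': "h' \<in> N"
        and sh: "\<And>i. i \<in> I ?l g \<Longrightarrow> x i = c ?l g h' i" for x g h'
    proof -
      have xO: "x \<in> ?O" using x DO by blast
      obtain h where h: "h \<in> N" "v 0 x \<otimes> t \<otimes> h \<notin> E" using x by (auto simp: D_def C_def)
      obtain h1 where h1: "h1 \<in> N" "v ?l x = v 0 x \<otimes> t \<otimes> h1"
        using value_modulo_subgroup[OF N w[of 0] w[OF l] xO] x hit_iff[OF l xO]
        unfolding v_def D_def X_def by auto
      \<comment> \<open>The gadget has to show \<open>h \<otimes> inv h1 \<otimes> h'\<close> in order to change the value \<open>u \<otimes> h1\<close> into \<open>u \<otimes> h\<close>.\<close>
      define u where "u = v 0 x \<otimes> t"
      define \<rho> where "\<rho> = part (w ?l) ({..<n} - I ?l g) x"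
      have cl: "h \<in> carrier H" "h1 \<in> carrier H" "h' \<in> carrier H" "u \<in> carrier H" "\<rho> \<in> carrier H"
        using h h1 h' N subgroup.subset v_closed[of 0 x] xO t_carrier rest_closed[OF l xO]
        by (auto simp: u_def \<rho>_def)
      have eq: "h' \<otimes> \<rho> = u \<otimes> h1"
        using v_ov[OF l1 l g h' _ xO, of ?l] shown[OF sh] h1(2) by (simp add: u_def \<rho>_def)
      have hN: "h \<otimes> inv h1 \<otimes> h' \<in> N"
        using h(1) h1(1) h' N by (intro subgroup.m_closed[OF N] subgroup.m_inv_closed[OF N])
      have "v ?l (override_on x (c ?l g (h \<otimes> inv h1 \<otimes> h')) (I ?l g)) = h \<otimes> inv h1 \<otimes> h' \<otimes> \<rho>"
        using v_ov[OF l1 l g hN _ xO, of ?l] by (simp add: \<rho>_def)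
      also have "\<dots> = h \<otimes> inv h1 \<otimes> (u \<otimes> h1)" using cl eq by (simp add: m_assoc)
      also have "\<dots> = u \<otimes> h"
      proof -
        have "h \<otimes> inv h1 \<otimes> (u \<otimes> h1) = (h \<otimes> inv h1) \<otimes> (h1 \<otimes> u)" using cl by (simp add: m_comm)
        also have "\<dots> = h \<otimes> (inv h1 \<otimes> (h1 \<otimes> u))" using cl by (simp add: m_assoc)
        also have "\<dots> = h \<otimes> u" using cl by (simp add: m_assoc[symmetric])
        finally show ?thesis using cl by (simp add: m_comm)
      qed
      finally show ?thesis using h(2) hN unfolding u_def by (intro bexI[of _ "h \<otimes> inv h1 \<otimes> h'"]) auto
    qed
    have "sum (wt ?l) {x \<in> D. \<not> v ?l x \<notin> E}
        \<le> real (order H) / (real (order H) + 1) * sum (wt ?l) D + real (card ?O) * (1 - 1 / ?\<sigma> ^ q) ^ m"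
    proof (rule gadgets_force_failures[where I="I ?l" and c="c ?l" and N=N])
      show "wt ?l (override_on x (c ?l g h) (I ?l g)) = wt ?l x"
        if "g < m" "h \<in> N" for x g h
        unfolding wt_def using that l hit_ov[OF l1 l that(1)] by (intro prod.cong) auto
      show "\<exists>h\<in>N. v ?l (override_on x (c ?l g h) (I ?l g)) \<notin> E"
        if "x \<in> D" "g < m" "h' \<in> N" "\<And>i. i \<in> I ?l g \<Longrightarrow> x i = c ?l g h' i" for x g h'
        using that by (rule D_fail)
      show "override_on x (c ?l g h) (I ?l g) \<in> D"
        if "x \<in> D" "g < m" "h \<in> N" "h' \<in> N" "\<And>i. i \<in> I ?l g \<Longrightarrow> x i = c ?l g h' i" for x g h h'
        using that by (rule C_ov)
      show "I ?l g \<inter> I ?l g' = {}" if "g < m" "g' < m" "g \<noteq> g'" for g g'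
        using I_dis[OF l1 l] that by blast
    qed (use finite_S Ss DO finN oneN cardN wt01 I[OF l1 l] gadD(1)[OF l1 l] in auto)
    then have good: "sum (wt ?l) {x \<in> D. v ?l x \<in> E} \<le> \<theta> * sum (wt ?l) D + \<delta>"
      by (simp add: \<theta>_def \<delta>_def)
    have wtl: "wt l x = (if hit ?l x then \<theta> else 1) * wt ?l x" for x
    proof -
      have "{l<..d} = insert ?l {?l<..d}" using l by auto
      then show ?thesis by (simp add: wt_def)
    qed
    have "{1..?l} = insert ?l {1..l}" by auto
    then have C_Suc: "C ?l = {x \<in> C l. v ?l x \<in> E}" by (auto simp: C_def)
    have "C ?l = {x \<in> D. v ?l x \<in> E} \<union> {x \<in> C l - D. v ?l x \<in> E}"
      unfolding C_Suc D_def by auto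
    then have "sum (wt ?l) (C ?l) = sum (wt ?l) {x \<in> D. v ?l x \<in> E} + sum (wt ?l) {x \<in> C l - D. v ?l x \<in> E}"
      using finC[of l] by (simp add: D_def sum.union_disjoint disjoint_iff)
    also have "\<dots> \<le> (\<theta> * sum (wt ?l) D + \<delta>) + sum (wt ?l) (C l - D)"
      using good finC[of l] wt01 by (intro add_mono sum_mono2) auto
    also have "\<theta> * sum (wt ?l) D = sum (wt l) D"
      unfolding sum_distrib_left by (intro sum.cong) (auto simp: wtl D_def)
    also have "sum (wt ?l) (C l - D) = sum (wt l) (C l - D)"
      by (intro sum.cong) (auto simp: wtl D_def)
    also have "sum (wt l) D + \<delta> + sum (wt l) (C l - D) = sum (wt l) (C l) + \<delta>"
      using sum.subset_diff[of D "C l" "wt l"] finC[of l] by (simp add: D_def)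
    finally show ?thesis .
  qed
  have steps: "sum (wt l) (C l) \<le> sum (wt 0) (C 0) + real l * \<delta>" if "l \<le> d" for l
    using that
  proof (induction l)
    case (Suc l)
    then show ?case using rung[of l] by (simp add: algebra_simps)
  qed simp
  have "\<exists>y. \<forall>j\<in>{0<..d}. y j \<in> X j \<rightarrow> S \<and> part (quot (w 0) (w j)) (X j) (y j) = t"
  proof (intro bchoice ballI)
    fix j assume "j \<in> {0<..d}"
    then have "t \<in> reach (quot (w 0) (w j)) S (X j)" using t[of j] by simp
    then show "\<exists>y. y \<in> X j \<rightarrow> S \<and> part (quot (w 0) (w j)) (X j) y = t"
      by (auto simp: reach_def part_def)
  qed
  then obtain y where y: "\<And>j. j \<in> {0<..d} \<Longrightarrow> y j \<in> X j \<rightarrow> S \<and> part (quot (w 0) (w j)) (X j) (y j) = t"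
    by blast
  have "sum (wt 0) (C 0) \<le> sum (wt 0) ?O"
    using finO wt01 by (intro sum_mono2) (auto simp: C_def)
  also have "\<dots> = (\<Sum>x\<in>?O. \<Prod>j\<in>{0<..d}. if hit j x then \<theta> else 1)" by (simp add: wt_def)
  also have "\<dots> \<le> real (card ?O) * (1 - (1 - \<theta>) / ?\<sigma> ^ r) ^ card {0<..d}"
  proof (rule sum_prod_disjoint_supports[where X=X and c=y])
    show "(if hit j x then \<theta> else 1) = (if hit j x' then \<theta> else 1)" if "\<And>i. i \<in> X j \<Longrightarrow> x i = x' i" for j x x'
      using hit_local[of j x x'] that by simp
    show "(if hit j x then \<theta> else 1) \<le> 1 - (1 - \<theta>)" if "j \<in> {0<..d}" "\<And>i. i \<in> X j \<Longrightarrow> x i = y j i" for j x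
    proof -
      have "part (quot (w 0) (w j)) (X j) (restrict x (X j)) = part (quot (w 0) (w j)) (X j) (y j)"
        using that y[OF that(1)] quot_closed[OF w[of 0] w[of j]] Xn[of j]
        by (intro part_cong) (auto simp: Pi_iff)
      then show ?thesis using y[OF that(1)] by (simp add: hit_def)
    qed
  qed (use finite_S Ss \<theta> X_card X_dis Xn y in auto)
  finally have C0: "sum (wt 0) (C 0) \<le> real (card ?O) * (1 - (1 - \<theta>) / ?\<sigma> ^ r) ^ d" by simp
  have \<theta>': "1 - \<theta> = 1 / (real (order H) + 1)" by (simp add: \<theta>_def field_simps)
  have "real (card (C d)) = sum (wt d) (C d)" by (simp add: wt_def)
  also have "\<dots> \<le> real (card ?O) * (1 - (1 - \<theta>) / ?\<sigma> ^ r) ^ d + real d * \<delta>"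
    using steps[of d] C0 by simp
  also have "\<dots> = real (card ?O) * ((1 - 1 / ((real (order H) + 1) * ?\<sigma> ^ r)) ^ d + real d * (1 - 1 / ?\<sigma> ^ q) ^ m)"
    by (simp add: \<theta>' \<delta>_def algebra_simps)
  finally show ?thesis by (simp add: C_def v_def)
qed

end

section \<open>Approximation by a long ladder\<close>

context letter_system
begin

definition letter_conditions :: "nat \<Rightarrow> ((nat \<Rightarrow> 's \<Rightarrow> 'h) \<times> 'h set) set" where
  "letter_conditions n = words n \<times> Pow (carrier H)"

definition holds :: "nat \<Rightarrow> ((nat \<Rightarrow> 's \<Rightarrow> 'h) \<times> 'h set) set \<Rightarrow> (nat \<Rightarrow> 's) \<Rightarrow> bool" where
  "holds n \<C> x \<longleftrightarrow> (\<forall>(w, E)\<in>\<C>. part w {..<n} x \<in> E)"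

definition approximable :: "real \<Rightarrow> nat \<Rightarrow> nat \<Rightarrow> ((nat \<Rightarrow> 's \<Rightarrow> 'h) \<times> 'h set) set \<Rightarrow> bool" where
  "approximable \<epsilon> A n \<G> \<longleftrightarrow>
     (\<exists>\<F>\<subseteq>letter_conditions n. finite \<F> \<and> card \<F> \<le> A \<and>
        (\<forall>x\<in>set_power S n. holds n \<F> x \<longrightarrow> holds n \<G> x) \<and>
        real (card {x \<in> set_power S n. holds n \<G> x \<and> \<not> holds n \<F> x})
          \<le> \<epsilon> * real (card (set_power S n)))"

lemma approximable_mono:
  assumes "approximable \<epsilon> A n \<G>" "\<epsilon> \<le> \<epsilon>'" "A \<le> A'"
  shows "approximable \<epsilon>' A' n \<G>"
proof -
  have "\<epsilon> * real (card (set_power S n)) \<le> \<epsilon>' * real (card (set_power S n))"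
    using assms(2) by (rule mult_right_mono) simp
  then show ?thesis
    using assms(1,3) unfolding approximable_def by (meson order_trans)
qed

lemma approximable_empty: "0 \<le> \<epsilon> \<Longrightarrow> approximable \<epsilon> A n {}"
  unfolding approximable_def by (intro exI[of _ "{}"]) (simp add: holds_def)

text \<open>
  Approximations of the parts of a finite partition are united; the losses and the sizes add up.
\<close>

lemma approximable_by_cases:
  assumes K: "finite K" "card K \<le> k" and key: "\<And>g. g \<in> \<G> \<Longrightarrow> key g \<in> K" and "0 \<le> \<epsilon>"
    and each: "\<And>\<kappa>. \<kappa> \<in> K \<Longrightarrow> approximable \<epsilon> A n {g \<in> \<G>. key g = \<kappa>}"
  shows "approximable (real k * \<epsilon>) (k * A) n \<G>"
proof -
  let ?O = "set_power S n" and ?G = "\<lambda>\<kappa>. {g \<in> \<G>. key g = \<kappa>}"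
  have "\<forall>\<kappa>\<in>K. \<exists>\<F>\<subseteq>letter_conditions n. finite \<F> \<and> card \<F> \<le> A \<and>
        (\<forall>x\<in>?O. holds n \<F> x \<longrightarrow> holds n (?G \<kappa>) x) \<and>
        real (card {x \<in> ?O. holds n (?G \<kappa>) x \<and> \<not> holds n \<F> x}) \<le> \<epsilon> * real (card ?O)"
    using each unfolding approximable_def by blast
  then obtain \<Phi> where \<Phi>: "\<And>\<kappa>. \<kappa> \<in> K \<Longrightarrow> \<Phi> \<kappa> \<subseteq> letter_conditions n \<and> finite (\<Phi> \<kappa>) \<and> card (\<Phi> \<kappa>) \<le> A \<and>
        (\<forall>x\<in>?O. holds n (\<Phi> \<kappa>) x \<longrightarrow> holds n (?G \<kappa>) x) \<and>
        real (card {x \<in> ?O. holds n (?G \<kappa>) x \<and> \<not> holds n (\<Phi> \<kappa>) x}) \<le> \<epsilon> * real (card ?O)"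
    by (auto dest!: bchoice)
  let ?F = "\<Union>\<kappa>\<in>K. \<Phi> \<kappa>"
  have "card ?F \<le> (\<Sum>\<kappa>\<in>K. card (\<Phi> \<kappa>))" using K(1) by (rule card_UN_le)
  also have "\<dots> \<le> (\<Sum>\<kappa>\<in>K. A)" using \<Phi> by (intro sum_mono) blast
  also have "\<dots> \<le> k * A" using K(2) by simp
  finally have cF: "card ?F \<le> k * A" .
  have imp: "holds n \<G> x" if "x \<in> ?O" "holds n ?F x" for x
  proof -
    have "holds n (?G \<kappa>) x" if "\<kappa> \<in> K" for \<kappa>
      using \<Phi>[OF that] \<open>x \<in> ?O\<close> \<open>holds n ?F x\<close> that by (auto simp: holds_def)
    then show ?thesis using key by (fastforce simp: holds_def)
  qed
  let ?bad = "\<lambda>\<kappa>. {x \<in> ?O. holds n (?G \<kappa>) x \<and> \<not> holds n (\<Phi> \<kappa>) x}"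
  have finO: "finite ?O" using finite_S by (rule finite_set_power)
  have "{x \<in> ?O. holds n \<G> x \<and> \<not> holds n ?F x} \<subseteq> (\<Union>\<kappa>\<in>K. ?bad \<kappa>)"
    by (auto simp: holds_def)
  then have "card {x \<in> ?O. holds n \<G> x \<and> \<not> holds n ?F x} \<le> card (\<Union>\<kappa>\<in>K. ?bad \<kappa>)"
    using K(1) finO by (intro card_mono) auto
  also have "\<dots> \<le> (\<Sum>\<kappa>\<in>K. card (?bad \<kappa>))" using K(1) by (rule card_UN_le)
  finally have "real (card {x \<in> ?O. holds n \<G> x \<and> \<not> holds n ?F x}) \<le> (\<Sum>\<kappa>\<in>K. real (card (?bad \<kappa>)))"
    using of_nat_mono by fastforce
  also have "\<dots> \<le> (\<Sum>\<kappa>\<in>K. \<epsilon> * real (card ?O))" using \<Phi> by (intro sum_mono) blast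
  also have "\<dots> = real (card K) * (\<epsilon> * real (card ?O))" by simp
  also have "\<dots> \<le> real k * (\<epsilon> * real (card ?O))"
    using K(2) \<open>0 \<le> \<epsilon>\<close> by (intro mult_right_mono) auto
  finally have loss: "real (card {x \<in> ?O. holds n \<G> x \<and> \<not> holds n ?F x}) \<le> real k * \<epsilon> * real (card ?O)"
    by (simp add: mult.assoc)
  show ?thesis
    unfolding approximable_def
    using cF imp loss \<Phi> K(1) by (intro exI[of _ ?F]) blast
qed

text \<open>
  The disjointness and gadget hypotheses of \<open>ladder_loss\<close> as one predicate. The rungs are numbered from \<open>1\<close>, and index \<open>0\<close> holds the centre
  \<open>w0\<close>, which the gadgets have to leave alone as well.
\<close>

definition ladder where
  "ladder n N m q W w0 d w I c \<longleftrightarrow>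
     w 0 = w0 \<and> (\<forall>l\<in>{1..d}. w l \<in> W) \<and>
     (\<forall>l\<in>{1..d}. \<forall>k\<in>{1..d}. l \<noteq> k \<longrightarrow> exceptional n N w0 (w l) \<inter> exceptional n N w0 (w k) = {}) \<and>
     (\<forall>l\<in>{1..d}. \<forall>g<m. I l g \<subseteq> {..<n} \<and> card (I l g) \<le> q \<and> gadget N w l (I l g) (c l g)) \<and>
     (\<forall>l\<in>{1..d}. \<forall>g<m. \<forall>g'<m. g \<noteq> g' \<longrightarrow> I l g \<inter> I l g' = {}) \<and>
     (\<forall>l\<in>{1..d}. \<forall>k\<in>{1..d}. \<forall>g<m. I l g \<inter> exceptional n N w0 (w k) = {})"

text \<open>
  A long ladder allows the whole family to be replaced by one condition on the centre. A word of the family has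
  value \<open>w0 \<otimes> t \<otimes> h\<close> with \<open>t \<in> T\<close> and \<open>h \<in> N\<close>, so it is enough to ask that all these products lie in \<open>E\<close>;
  by the ladder, few points satisfy the family without this stronger property.
\<close>

lemma approximable_of_ladder:
  fixes I :: "nat \<Rightarrow> nat \<Rightarrow> nat set" and c :: "nat \<Rightarrow> nat \<Rightarrow> 'h \<Rightarrow> nat \<Rightarrow> 's"
  assumes N: "subgroup N H" and w0: "w0 \<in> words n"
    and G: "\<G> \<subseteq> letter_conditions n"
    and E: "\<And>g. g \<in> \<G> \<Longrightarrow> snd g = E"
    and X: "\<And>g. g \<in> \<G> \<Longrightarrow> card (exceptional n N w0 (fst g)) \<le> r"
    and T: "\<And>g. g \<in> \<G> \<Longrightarrow> reach (quot w0 (fst g)) S (exceptional n N w0 (fst g)) = T"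
    and T_carrier: "T \<subseteq> carrier H"
    and lad: "ladder n N m q (fst ` \<G>) w0 d w I c"
  shows "approximable (real (order H) * ((1 - 1 / ((real (order H) + 1) * real (card S) ^ r)) ^ d
               + real d * (1 - 1 / real (card S) ^ q) ^ m)) 1 n \<G>"
proof -
  let ?O = "set_power S n"
  let ?\<delta> = "(1 - 1 / ((real (order H) + 1) * real (card S) ^ r)) ^ d + real d * (1 - 1 / real (card S) ^ q) ^ m"
  define E' where "E' = {u \<in> carrier H. \<forall>t\<in>T. \<forall>h\<in>N. u \<otimes> t \<otimes> h \<in> E}"
  define bad where "bad t = {x \<in> ?O. (\<exists>h\<in>N. part w0 {..<n} x \<otimes> t \<otimes> h \<notin> E) \<and>
                       (\<forall>l\<in>{1..d}. part (w l) {..<n} x \<in> E)}" for t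
  have w_0: "w 0 = w0" and wG: "\<And>l. 1 \<le> l \<Longrightarrow> l \<le> d \<Longrightarrow> w l \<in> fst ` \<G>"
    using lad by (auto simp: ladder_def)
  have Gw: "fst g \<in> words n" if "g \<in> \<G>" for g using G that by (auto simp: letter_conditions_def)
  have finO: "finite ?O" using finite_S by (rule finite_set_power)
  have finT: "finite T" using T_carrier finite_H finite_subset by blast
  have bad: "real (card (bad t)) \<le> real (card ?O) * ?\<delta>" if t: "t \<in> T" for t
    unfolding bad_def w_0[symmetric]
  proof (rule ladder_loss[where I=I and c=c])
    show "w l \<in> words n" if "l \<le> d" for l
    proof (cases "l = 0")
      case True then show ?thesis using w_0 w0 by simp
    next
      case False then show ?thesis using wG[of l] Gw that by auto
    qed
    show "card (exceptional n N (w 0) (w l)) \<le> r" if "1 \<le> l" "l \<le> d" for l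
      using wG[OF that] X w_0 by auto
    show "t \<in> reach (quot (w 0) (w l)) S (exceptional n N (w 0) (w l))" if "1 \<le> l" "l \<le> d" for l
      using wG[OF that] T t w_0 by auto
    show "t \<in> carrier H" using t T_carrier by blast
  qed (use N lad in \<open>simp_all add: ladder_def\<close>)
  have imp: "part w {..<n} x \<in> E" if x: "x \<in> ?O" and wE: "(w, F) \<in> \<G>" and u: "part w0 {..<n} x \<in> E'" for x w F
  proof -
    let ?X = "exceptional n N w0 w"
    have w: "w \<in> words n" using Gw wE by force
    obtain h where h: "h \<in> N" "part w {..<n} x = part w0 {..<n} x \<otimes> part (quot w0 w) ?X x \<otimes> h"
      using value_modulo_subgroup[OF N w0 w x] by blast
    have "x \<in> ?X \<rightarrow> S" using set_powerD[OF x] exceptional_subset by (auto simp: exceptional_def)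
    then have "part (quot w0 w) ?X x \<in> T"
      using T[OF wE] unfolding reach_def part_def by auto
    then show ?thesis using u h by (simp add: E'_def)
  qed
  have closed: "part w0 {..<n} x \<in> carrier H" if "x \<in> ?O" for x
    using words_closed[OF w0] set_powerD[OF that] by (intro part_closed) auto
  have "{x \<in> ?O. holds n \<G> x \<and> \<not> holds n {(w0, E')} x} \<subseteq> (\<Union>t\<in>T. bad t)"
  proof
    fix x assume "x \<in> {x \<in> ?O. holds n \<G> x \<and> \<not> holds n {(w0, E')} x}"
    then have x: "x \<in> ?O" "holds n \<G> x" "part w0 {..<n} x \<notin> E'" by (auto simp: holds_def)
    then obtain t where t: "t \<in> T" "\<exists>h\<in>N. part w0 {..<n} x \<otimes> t \<otimes> h \<notin> E"
      using closed[OF x(1)] by (auto simp: E'_def)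
    have "part (w l) {..<n} x \<in> E" if "1 \<le> l" "l \<le> d" for l
      using wG[OF that] x(2) E by (force simp: holds_def)
    then show "x \<in> (\<Union>t\<in>T. bad t)" using t x(1) by (auto simp: bad_def)
  qed
  then have "card {x \<in> ?O. holds n \<G> x \<and> \<not> holds n {(w0, E')} x} \<le> card (\<Union>t\<in>T. bad t)"
    using finT finO by (intro card_mono) (auto simp: bad_def)
  also have "\<dots> \<le> (\<Sum>t\<in>T. card (bad t))" using finT by (rule card_UN_le)
  finally have "real (card {x \<in> ?O. holds n \<G> x \<and> \<not> holds n {(w0, E')} x}) \<le> (\<Sum>t\<in>T. real (card (bad t)))"
    using of_nat_mono by fastforce
  also have "\<dots> \<le> (\<Sum>t\<in>T. real (card ?O) * ?\<delta>)" using bad by (rule sum_mono)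
  also have "\<dots> = real (card T) * (real (card ?O) * ?\<delta>)" by simp
  also have "\<dots> \<le> real (order H) * (real (card ?O) * ?\<delta>)"
  proof (rule mult_right_mono)
    show "real (card T) \<le> real (order H)"
      unfolding order_def using T_carrier finite_H by (simp add: card_mono)
    have "1 \<le> real (card S)" using finite_S s0 by (auto simp: Suc_le_eq card_gt_0_iff)
    then have p: "1 \<le> real (card S) ^ r" "1 \<le> real (card S) ^ q" by (rule one_le_power)+
    have "1 * 1 \<le> (real (order H) + 1) * real (card S) ^ r" using p(1) by (intro mult_mono) auto
    then have "0 \<le> 1 - 1 / ((real (order H) + 1) * real (card S) ^ r)" by simp
    moreover have "0 \<le> 1 - 1 / real (card S) ^ q" using p(2) by (auto simp: divide_le_eq_1)
    ultimately show "0 \<le> real (card ?O) * ?\<delta>"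
      by (intro mult_nonneg_nonneg add_nonneg_nonneg zero_le_power) auto
  qed
  finally have loss: "real (card {x \<in> ?O. holds n \<G> x \<and> \<not> holds n {(w0, E')} x})
      \<le> real (order H) * ?\<delta> * real (card ?O)" by (simp add: mult_ac)
  have "{(w0, E')} \<subseteq> letter_conditions n" using w0 by (auto simp: letter_conditions_def E'_def)
  moreover have "\<forall>x\<in>?O. holds n {(w0, E')} x \<longrightarrow> holds n \<G> x"
    using imp E by (fastforce simp: holds_def)
  ultimately show ?thesis
    unfolding approximable_def using loss by (intro exI[of _ "{(w0, E')}"]) simp
qed

end

section \<open>The structure of words without gadgets\<close>

lemma (in group) mult_inv_eqI:
  "x \<otimes> c = c' \<Longrightarrow> x \<in> carrier G \<Longrightarrow> c \<in> carrier G \<Longrightarrow> c' \<otimes> inv c = x"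
  by (auto simp: m_assoc)

lemma comm_group_product_group:
  assumes "\<And>i. i \<in> I \<Longrightarrow> comm_group (G i)"
  shows "comm_group (product_group I G)"
proof (rule group.group_comm_groupI)
  show "group (product_group I G)"
    using assms by (simp add: comm_group.axioms(2) comm_group_def)
  show "x \<otimes>\<^bsub>product_group I G\<^esub> y = y \<otimes>\<^bsub>product_group I G\<^esub> x"
    if "x \<in> carrier (product_group I G)" "y \<in> carrier (product_group I G)" for x y
    using that assms by (auto intro!: restrict_ext comm_monoid.m_comm simp: comm_group_def PiE_iff)
qed

lemma finprod_product_group:
  assumes "\<And>i. i \<in> I \<Longrightarrow> comm_group (G i)" "l \<in> I" "finite A" "f \<in> A \<rightarrow> carrier (product_group I G)"
  shows "finprod (product_group I G) f A l = finprod (G l) (\<lambda>a. f a l) A"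
  using assms(3,4)
proof (induction A)
  case empty
  interpret P: comm_group "product_group I G" using assms(1) by (rule comm_group_product_group)
  interpret Gl: comm_group "G l" using assms(1)[OF assms(2)] .
  show ?case using assms(2) P.finprod_empty by simp
next
  case (insert a A)
  interpret P: comm_group "product_group I G" using assms(1) by (rule comm_group_product_group)
  interpret Gl: comm_group "G l" using assms(1)[OF assms(2)] .
  have f: "f \<in> A \<rightarrow> carrier (product_group I G)" "f a \<in> carrier (product_group I G)"
    using insert.prems by auto
  then have fl: "(\<lambda>a. f a l) \<in> A \<rightarrow> carrier (G l)" "f a l \<in> carrier (G l)"
    using assms(2) by (auto simp: PiE_iff)
  have "finprod (product_group I G) f (insert a A)
      = f a \<otimes>\<^bsub>product_group I G\<^esub> finprod (product_group I G) f A"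
    using insert.hyps f by (intro P.finprod_insert)
  then have "finprod (product_group I G) f (insert a A) l = f a l \<otimes>\<^bsub>G l\<^esub> finprod (G l) (\<lambda>a. f a l) A"
    using insert.IH[OF f(1)] assms(2) by simp
  also have "\<dots> = finprod (G l) (\<lambda>a. f a l) (insert a A)"
    using insert.hyps fl by (intro Gl.finprod_insert[symmetric])
  finally show ?case .
qed

context letter_system
begin

abbreviation tuples :: "nat \<Rightarrow> (nat \<Rightarrow> 'h) monoid" where
  "tuples j \<equiv> product_group {..j} (\<lambda>_. H)"

text \<open>
  The letters of the words \<open>w 0, \<dots>, w j\<close> at one coordinate form a letter with values in \<open>H\<^sup>j\<^sup>+\<^sup>1\<close>. Moving
  \<open>w j\<close> while the others stay fixed means realising elements of the last factor, embedded by \<open>lift\<close> below.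
\<close>

definition column :: "nat \<Rightarrow> (nat \<Rightarrow> nat \<Rightarrow> 's \<Rightarrow> 'h) \<Rightarrow> nat \<Rightarrow> 's \<Rightarrow> nat \<Rightarrow> 'h" where
  "column j w i s = (\<lambda>l\<in>{..j}. w l i s)"

definition lift :: "nat \<Rightarrow> 'h \<Rightarrow> nat \<Rightarrow> 'h" where
  "lift j h = (\<lambda>l\<in>{..j}. if l = j then h else \<one>)"

lemma comm_group_tuples: "comm_group (tuples j)"
  by (intro comm_group_product_group) (rule comm_group_axioms)

lemma order_tuples: "order (tuples j) = order H ^ Suc j"
  unfolding order_def by (simp add: card_PiE)

text \<open>
  Apply \<open>robust_reach\<close> to the columns. If the subgroup \<open>L\<close> contains the copy \<open>lift j ` N\<close> of \<open>N\<close>, then its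
  realisations on few coordinates are gadgets for the last word. Otherwise the letters of the last word are tied
  to those of the earlier ones: away from \<open>Z\<close> the latter determine them, within a coset of \<open>N\<close>, up to the proper subgroup
  of those \<open>h \<in> N\<close> with \<open>lift j h \<in> L\<close>.
\<close>

lemma gadgets_or_smaller_coset:
  fixes j b m n :: nat
  defines "p \<equiv> order H ^ Suc j"
  assumes "\<forall>l\<le>j. w l \<in> words n"
  shows "\<exists>Z L. Z \<subseteq> {..<n} \<and> card Z \<le> p * (b + m * p) \<and> subgroup L (tuples j) \<and>
           (\<forall>i\<in>{..<n} - Z. \<forall>s\<in>S. column j w i s \<in> L) \<and>
           (lift j ` N \<subseteq> L \<longrightarrow>
             (\<forall>Y. finite Y \<longrightarrow> card Y \<le> b \<longrightarrow>
                (\<exists>I c. (\<forall>g<m. I g \<subseteq> {..<n} - Y \<and> card (I g) \<le> p \<and> gadget N w j (I g) (c g)) \<and>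
                       (\<forall>g<m. \<forall>g'<m. g \<noteq> g' \<longrightarrow> I g \<inter> I g' = {}))))"
proof -
  interpret P: comm_group "tuples j" by (rule comm_group_tuples)
  have w: "\<And>l. l \<le> j \<Longrightarrow> w l \<in> words n" using assms(2) by blast
  have p: "order (tuples j) = p" by (simp add: p_def order_tuples)
  have col: "column j w i s \<in> carrier (tuples j)" if "i \<in> {..<n}" "s \<in> S" for i s
    using words_closed[OF w] that by (auto simp: column_def)
  have base: "column j w i s0 = \<one>\<^bsub>tuples j\<^esub>" if "i \<in> {..<n}" for i
    using w that by (auto simp: column_def words_def M_base)
  obtain Z L where Z: "Z \<subseteq> {..<n}" "card Z \<le> p * (b + m * p)" "subgroup L (tuples j)"
      "\<forall>i\<in>{..<n} - Z. \<forall>s\<in>S. column j w i s \<in> L"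
    and R: "\<And>Y. finite Y \<Longrightarrow> card Y \<le> b \<Longrightarrow>
       \<exists>I. (\<forall>g<m. I g \<subseteq> {..<n} - Y \<and> finite (I g) \<and> card (I g) \<le> p \<and> L \<subseteq> P.reach (column j w) S (I g)) \<and>
                   (\<forall>g<m. \<forall>g'<m. g \<noteq> g' \<longrightarrow> I g \<inter> I g' = {})"
    using P.robust_reach[of s0 S "{..<n}" "column j w" b m, OF _ s0 col base] finite_H
    unfolding p by (auto simp: finite_PiE)
  have "\<exists>I c. (\<forall>g<m. I g \<subseteq> {..<n} - Y \<and> card (I g) \<le> p \<and> gadget N w j (I g) (c g)) \<and>
              (\<forall>g<m. \<forall>g'<m. g \<noteq> g' \<longrightarrow> I g \<inter> I g' = {})"
    if NL: "lift j ` N \<subseteq> L" and Y: "finite Y" "card Y \<le> b" for Y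
  proof -
    obtain I where I: "\<And>g. g < m \<Longrightarrow> I g \<subseteq> {..<n} - Y \<and> finite (I g) \<and> card (I g) \<le> p \<and> L \<subseteq> P.reach (column j w) S (I g)"
      and dis: "\<forall>g<m. \<forall>g'<m. g \<noteq> g' \<longrightarrow> I g \<inter> I g' = {}"
      using R[OF Y] by blast
    have "\<exists>c. gadget N w j (I g) c" if g: "g < m" for g
    proof -
      have "\<exists>y. y \<in> I g \<rightarrow> S \<and> (\<forall>a<j. part (w a) (I g) y = \<one>) \<and> part (w j) (I g) y = h" if h: "h \<in> N" for h
      proof -
        have "lift j h \<in> P.reach (column j w) S (I g)" using I[OF g] NL h by blast
        then obtain y where y: "y \<in> I g \<rightarrow> S" "lift j h = finprod (tuples j) (\<lambda>i. column j w i (y i)) (I g)"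
          by (auto simp: P.reach_def)
        have cy: "(\<lambda>i. column j w i (y i)) \<in> I g \<rightarrow> carrier (tuples j)"
          using col I[OF g] y(1) by (auto simp del: carrier_product_group)
        have "part (w a) (I g) y = lift j h a" if a: "a \<le> j" for a
        proof -
          have "lift j h a = finprod H (\<lambda>i. column j w i (y i) a) (I g)"
            unfolding y(2) using I[OF g] a cy comm_group_axioms by (intro finprod_product_group) auto
          also have "\<dots> = part (w a) (I g) y"
            unfolding part_def using a by (simp add: column_def)
          finally show ?thesis by simp
        qed
        then show ?thesis using y(1) by (intro exI[of _ y]) (auto simp: lift_def)
      qed
      then show ?thesis unfolding gadget_def by (intro bchoice) blast
    qed
    then obtain c where "\<And>g. g < m \<Longrightarrow> gadget N w j (I g) (c g)" by metis
    then show ?thesis using I dis by (intro exI[of _ I] exI[of _ c]) blast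
  qed
  then show ?thesis using Z by (intro exI[of _ Z] exI[of _ L]) blast
qed

lemma lift_closed: "h \<in> carrier H \<Longrightarrow> lift j h \<in> carrier (tuples j)"
  by (auto simp: lift_def)

lemma subgroup_lift_preimage:
  assumes N: "subgroup N H" and L: "subgroup L (tuples j)"
  shows "subgroup {h \<in> N. lift j h \<in> L} H"
proof -
  interpret P: comm_group "tuples j" by (rule comm_group_tuples)
  have Nc: "N \<subseteq> carrier H" using N by (rule subgroup.subset)
  have one: "lift j \<one> = \<one>\<^bsub>tuples j\<^esub>" by (auto simp: lift_def)
  have mult: "lift j (h \<otimes> h') = lift j h \<otimes>\<^bsub>tuples j\<^esub> lift j h'" if "h \<in> carrier H" "h' \<in> carrier H" for h h'
    using that by (auto simp: lift_def)
  have inv: "lift j (inv h) = inv\<^bsub>tuples j\<^esub> (lift j h)" if "h \<in> carrier H" for h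
  proof -
    have "lift j (inv h) \<otimes>\<^bsub>tuples j\<^esub> lift j h = \<one>\<^bsub>tuples j\<^esub>"
      using that mult[of "inv h" h] one by simp
    then show ?thesis using that lift_closed by (intro P.inv_equality[symmetric]) auto
  qed
  show ?thesis
  proof (rule subgroupI)
    show "{h \<in> N. lift j h \<in> L} \<noteq> {}"
      using subgroup.one_closed[OF N] subgroup.one_closed[OF L] one by auto
    show "inv a \<in> {h \<in> N. lift j h \<in> L}" if "a \<in> {h \<in> N. lift j h \<in> L}" for a
      using that subgroup.m_inv_closed[OF N] subgroup.m_inv_closed[OF L] inv Nc by auto
    show "a \<otimes> a' \<in> {h \<in> N. lift j h \<in> L}"
      if "a \<in> {h \<in> N. lift j h \<in> L}" "a' \<in> {h \<in> N. lift j h \<in> L}" for a a'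
    proof -
      have "lift j (a \<otimes> a') = lift j a \<otimes>\<^bsub>tuples j\<^esub> lift j a'" using that Nc by (intro mult) auto
      then show ?thesis using that subgroup.m_closed[OF N] subgroup.m_closed[OF L, of "lift j a" "lift j a'"] by simp
    qed
  qed (use Nc in blast)
qed

text \<open>
  Where both columns lie in \<open>L\<close>, so does their quotient; the earlier words cancel in it and leave the lift of the
  quotient of the two letters. Hence words that share \<open>L\<close> agree up to the smaller subgroup and few coordinates.
\<close>

lemma exceptional_of_common_subgroup:
  assumes N: "subgroup N H" and L: "subgroup L (tuples j)"
    and w: "\<And>l. l < j \<Longrightarrow> w l \<in> words n" and w0: "w0 \<in> words n"
    and u: "u \<in> words n" and u': "u' \<in> words n"
    and Z: "\<forall>i\<in>{..<n} - Z. \<forall>s\<in>S. column j (w(j := u)) i s \<in> L"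
    and Z': "\<forall>i\<in>{..<n} - Z'. \<forall>s\<in>S. column j (w(j := u')) i s \<in> L"
  shows "exceptional n {h \<in> N. lift j h \<in> L} u u'
           \<subseteq> Z \<union> Z' \<union> exceptional n N w0 u \<union> exceptional n N w0 u'"
proof
  interpret P: comm_group "tuples j" by (rule comm_group_tuples)
  fix i assume i: "i \<in> exceptional n {h \<in> N. lift j h \<in> L} u u'"
  show "i \<in> Z \<union> Z' \<union> exceptional n N w0 u \<union> exceptional n N w0 u'"
  proof (rule ccontr)
    assume no: "i \<notin> Z \<union> Z' \<union> exceptional n N w0 u \<union> exceptional n N w0 u'"
    obtain s where s: "i < n" "s \<in> S" "quot u u' i s \<notin> {h \<in> N. lift j h \<in> L}"
      using i by (auto simp: exceptional_def)
    have cl: "u i s \<in> carrier H" "u' i s \<in> carrier H" "w0 i s \<in> carrier H"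
      using words_closed u u' w0 s by auto
    have "quot w0 u i s \<in> N" "quot w0 u' i s \<in> N" using no s by (auto simp: exceptional_def)
    then have "quot w0 u' i s \<otimes> inv (quot w0 u i s) \<in> N"
      using subgroup.m_closed[OF N] subgroup.m_inv_closed[OF N] by blast
    moreover have "quot w0 u' i s \<otimes> inv (quot w0 u i s) = quot u u' i s"
    proof -
      have "quot w0 u' i s \<otimes> inv (quot w0 u i s) = u' i s \<otimes> inv (w0 i s) \<otimes> (w0 i s \<otimes> inv (u i s))"
        using cl by (simp add: quot_def inv_mult m_comm)
      also have "\<dots> = u' i s \<otimes> (inv (w0 i s) \<otimes> (w0 i s \<otimes> inv (u i s)))"
        using cl by (simp add: m_assoc)
      also have "inv (w0 i s) \<otimes> (w0 i s \<otimes> inv (u i s)) = inv (u i s)"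
        using cl by (simp add: m_assoc[symmetric])
      finally show ?thesis by (simp add: quot_def)
    qed
    ultimately have inN: "quot u u' i s \<in> N" by simp
    let ?c = "column j (w(j := u)) i s" and ?c' = "column j (w(j := u')) i s"
    have c: "?c \<in> L" "?c' \<in> L" using Z Z' no s by auto
    have "lift j (quot u u' i s) \<otimes>\<^bsub>tuples j\<^esub> ?c = ?c'"
    proof -
      have "quot u u' i s \<otimes> u i s = u' i s" using cl by (simp add: quot_def m_assoc)
      then show ?thesis using words_closed[OF w] s by (auto simp: lift_def column_def intro!: restrict_ext)
    qed
    then have "?c' \<otimes>\<^bsub>tuples j\<^esub> inv\<^bsub>tuples j\<^esub> ?c = lift j (quot u u' i s)"
      using c subgroup.subset[OF L] lift_closed[OF quot_closed[OF u u' s(1,2)], of j]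
      by (intro P.mult_inv_eqI) auto
    moreover have "?c' \<otimes>\<^bsub>tuples j\<^esub> inv\<^bsub>tuples j\<^esub> ?c \<in> L"
      using c by (intro subgroup.m_closed[OF L] subgroup.m_inv_closed[OF L])
    ultimately have "lift j (quot u u' i s) \<in> L" by (simp only:)
    then show False using inN s(3) by simp
  qed
qed

end

section \<open>Ladders that get stuck\<close>

context letter_system
begin

lemma ladder_0: "ladder n N m q W w0 0 (\<lambda>_. w0) I c"
  by (simp add: ladder_def)

lemma maximal_ladder:
  "(\<exists>w I c. ladder n N m q W w0 d w I c) \<or>
   (\<exists>j<d. \<exists>w I c. ladder n N m q W w0 j w I c \<and> \<not> (\<exists>w I c. ladder n N m q W w0 (Suc j) w I c))"
proof (induction d)
  case 0 show ?case using ladder_0 by blast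
next
  case (Suc d) then show ?case using less_Suc_eq by blast
qed

lemma gadget_update: "l < k \<Longrightarrow> gadget N (w(k := u)) l I c = gadget N w l I c"
  by (simp add: gadget_def)

lemma ladder_extend:
  assumes lad: "ladder n N m q W w0 j w I c" and u: "u \<in> W"
    and Y: "\<And>l. l \<in> {1..j} \<Longrightarrow> exceptional n N w0 (w l) \<subseteq> Y"
           "\<And>l g. l \<in> {1..j} \<Longrightarrow> g < m \<Longrightarrow> I l g \<subseteq> Y"
    and uY: "exceptional n N w0 u \<inter> Y = {}"
    and I': "\<And>g. g < m \<Longrightarrow> I' g \<subseteq> {..<n} - (Y \<union> exceptional n N w0 u) \<and> card (I' g) \<le> q \<and>
                 gadget N (w(Suc j := u)) (Suc j) (I' g) (c' g)"
    and dis: "\<And>g g'. g < m \<Longrightarrow> g' < m \<Longrightarrow> g \<noteq> g' \<Longrightarrow> I' g \<inter> I' g' = {}"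
  shows "ladder n N m q W w0 (Suc j) (w(Suc j := u)) (I(Suc j := I')) (c(Suc j := c'))"
proof -
  have old: "w 0 = w0" "\<And>l. l \<in> {1..j} \<Longrightarrow> w l \<in> W"
    "\<And>l k. l \<in> {1..j} \<Longrightarrow> k \<in> {1..j} \<Longrightarrow> l \<noteq> k \<Longrightarrow> exceptional n N w0 (w l) \<inter> exceptional n N w0 (w k) = {}"
    "\<And>l g. l \<in> {1..j} \<Longrightarrow> g < m \<Longrightarrow> I l g \<subseteq> {..<n} \<and> card (I l g) \<le> q \<and> gadget N w l (I l g) (c l g)"
    "\<And>l g g'. l \<in> {1..j} \<Longrightarrow> g < m \<Longrightarrow> g' < m \<Longrightarrow> g \<noteq> g' \<Longrightarrow> I l g \<inter> I l g' = {}"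
    "\<And>l k g. l \<in> {1..j} \<Longrightarrow> k \<in> {1..j} \<Longrightarrow> g < m \<Longrightarrow> I l g \<inter> exceptional n N w0 (w k) = {}"
    using lad unfolding ladder_def by blast+
  have range: "{1..Suc j} = insert (Suc j) {1..j}" by auto
  have ne: "l \<noteq> Suc j" if "l \<in> {1..j}" for l using that by simp
  show ?thesis
    unfolding ladder_def range
  proof (intro conjI ballI allI impI)
    show "(w(Suc j := u)) 0 = w0" using old(1) by simp
  next
    fix l assume "l \<in> insert (Suc j) {1..j}"
    then show "(w(Suc j := u)) l \<in> W" using u old(2) by (cases "l = Suc j") auto
  next
    fix l k assume "l \<in> insert (Suc j) {1..j}" "k \<in> insert (Suc j) {1..j}" "l \<noteq> k"
    then consider "l = Suc j" "k \<in> {1..j}" | "k = Suc j" "l \<in> {1..j}" | "l \<in> {1..j}" "k \<in> {1..j}" by blast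
    then show "exceptional n N w0 ((w(Suc j := u)) l) \<inter> exceptional n N w0 ((w(Suc j := u)) k) = {}"
    proof cases
      case 1 then show ?thesis using Y(1)[of k] uY ne[of k] by auto
    next
      case 2 then show ?thesis using Y(1)[of l] uY ne[of l] by auto
    next
      case 3 then show ?thesis using old(3)[of l k] \<open>l \<noteq> k\<close> ne by simp
    qed
  next
    fix l g assume l: "l \<in> insert (Suc j) {1..j}" and g: "g < m"
    have "(I(Suc j := I')) l g \<subseteq> {..<n} \<and> card ((I(Suc j := I')) l g) \<le> q \<and>
        gadget N (w(Suc j := u)) l ((I(Suc j := I')) l g) ((c(Suc j := c')) l g)"
    proof (cases "l = Suc j")
      case True then show ?thesis using I'[OF g] by auto
    next
      case False
      then show ?thesis using old(4)[of l g] l g by (simp add: gadget_update)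
    qed
    then show "(I(Suc j := I')) l g \<subseteq> {..<n}" "card ((I(Suc j := I')) l g) \<le> q"
      "gadget N (w(Suc j := u)) l ((I(Suc j := I')) l g) ((c(Suc j := c')) l g)" by blast+
  next
    fix l g g' assume "l \<in> insert (Suc j) {1..j}" "g < m" "g' < m" "g \<noteq> g'"
    then show "(I(Suc j := I')) l g \<inter> (I(Suc j := I')) l g' = {}"
      using dis[of g g'] old(5)[of l g g'] by (cases "l = Suc j") simp_all
  next
    fix l k g assume "l \<in> insert (Suc j) {1..j}" "k \<in> insert (Suc j) {1..j}" and g: "g < m"
    then consider "l = Suc j" "k = Suc j" | "l = Suc j" "k \<in> {1..j}" | "k = Suc j" "l \<in> {1..j}"
      | "l \<in> {1..j}" "k \<in> {1..j}" by blast
    then show "(I(Suc j := I')) l g \<inter> exceptional n N w0 ((w(Suc j := u)) k) = {}"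
    proof cases
      case 1 then show ?thesis using I'[OF g] by auto
    next
      case 2 then show ?thesis using I'[OF g] Y(1)[of k] ne[of k] by auto
    next
      case 3 then show ?thesis using Y(2)[of l g] g uY ne[of l] by auto
    next
      case 4 then show ?thesis using old(6)[of l k g] g ne by simp
    qed
  qed
qed

lemma order_pos: "1 \<le> order H"
  unfolding order_def using finite_H one_closed by (auto simp: Suc_le_eq card_gt_0_iff)

text \<open>
  A ladder that cannot be extended exhibits structure in all words of the family. With \<open>Y\<close> the bounded set of
  coordinates already used by exceptional sets and gadgets, a word either has an exceptional coordinate in \<open>Y\<close>
  or, for lack of gadgets, is tied to the words of the ladder by a proper subgroup as in
  \<open>gadgets_or_smaller_coset\<close>.
\<close>

lemma stuck_ladder:
  fixes d m r n :: nat
  defines "q \<equiv> order H ^ Suc d"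
  defines "b \<equiv> d * (r + m * q) + r"
  assumes lad: "ladder n N m q W w0 j w I c" and "j < d"
    and stuck: "\<not> (\<exists>w I c. ladder n N m q W w0 (Suc j) w I c)"
    and W: "W \<subseteq> words n" and w0: "w0 \<in> words n"
    and exc: "\<forall>u\<in>W. card (exceptional n N w0 u) \<le> r"
  shows "\<exists>Y\<subseteq>{..<n}. card Y \<le> b \<and>
           (\<forall>u\<in>W. exceptional n N w0 u \<inter> Y \<noteq> {} \<or>
              (\<exists>Z L. Z \<subseteq> {..<n} \<and> card Z \<le> q * (b + m * q) \<and> subgroup L (tuples (Suc j)) \<and>
                 (\<forall>i\<in>{..<n} - Z. \<forall>s\<in>S. column (Suc j) (w(Suc j := u)) i s \<in> L) \<and>
                 \<not> lift (Suc j) ` N \<subseteq> L))"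
proof -
  have X: "card (exceptional n N w0 u) \<le> r" if "u \<in> W" for u using exc that by blast
  define Y where "Y = (\<Union>l\<in>{1..j}. exceptional n N w0 (w l) \<union> (\<Union>g\<in>{..<m}. I l g))"
  have w: "w l \<in> words n" if "l \<le> j" for l
    using lad W w0 that by (cases "l = 0") (auto simp: ladder_def)
  have wW: "w l \<in> W" if "l \<in> {1..j}" for l using lad that by (auto simp: ladder_def)
  have I: "I l g \<subseteq> {..<n}" "card (I l g) \<le> q" if "l \<in> {1..j}" "g < m" for l g
    using lad that by (auto simp: ladder_def)
  have Yn: "Y \<subseteq> {..<n}" unfolding Y_def using exceptional_subset(1) I(1) by blast
  then have finY: "finite Y" using finite_subset by blast
  have "card Y \<le> (\<Sum>l\<in>{1..j}. card (exceptional n N w0 (w l) \<union> (\<Union>g\<in>{..<m}. I l g)))"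
    unfolding Y_def by (rule card_UN_le) simp
  also have "\<dots> \<le> (\<Sum>l\<in>{1..j}. r + m * q)"
  proof (rule sum_mono)
    fix l assume l: "l \<in> {1..j}"
    have "card (\<Union>g\<in>{..<m}. I l g) \<le> (\<Sum>g\<in>{..<m}. card (I l g))" by (rule card_UN_le) simp
    also have "\<dots> \<le> (\<Sum>g\<in>{..<m}. q)" using I(2)[OF l] by (intro sum_mono) simp
    finally have "card (\<Union>g\<in>{..<m}. I l g) \<le> m * q" by simp
    then show "card (exceptional n N w0 (w l) \<union> (\<Union>g\<in>{..<m}. I l g)) \<le> r + m * q"
      using X[OF wW[OF l]] card_Un_le[of "exceptional n N w0 (w l)" "\<Union>g\<in>{..<m}. I l g"] by linarith
  qed
  also have "\<dots> = j * (r + m * q)" by simp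
  also have "\<dots> \<le> d * (r + m * q)" using \<open>j < d\<close> by (intro mult_right_mono) auto
  finally have cY: "card Y \<le> d * (r + m * q)" .
  have alt: "\<exists>Z L. Z \<subseteq> {..<n} \<and> card Z \<le> q * (b + m * q) \<and> subgroup L (tuples (Suc j)) \<and>
                 (\<forall>i\<in>{..<n} - Z. \<forall>s\<in>S. column (Suc j) (w(Suc j := u)) i s \<in> L) \<and>
                 \<not> lift (Suc j) ` N \<subseteq> L"
    if u: "u \<in> W" and uY: "exceptional n N w0 u \<inter> Y = {}" for u
  proof -
    let ?p = "order H ^ Suc (Suc j)" and ?U = "Y \<union> exceptional n N w0 u"
    have pq: "?p \<le> q" unfolding q_def using \<open>j < d\<close> order_pos by (intro power_increasing) auto
    have "\<forall>l\<le>Suc j. (w(Suc j := u)) l \<in> words n"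
      using w u W by auto
    from gadgets_or_smaller_coset[of "Suc j" "w(Suc j := u)" n b m N, OF this]
    obtain Z L where Z: "Z \<subseteq> {..<n}" "card Z \<le> ?p * (b + m * ?p)" "subgroup L (tuples (Suc j))"
        "\<forall>i\<in>{..<n} - Z. \<forall>s\<in>S. column (Suc j) (w(Suc j := u)) i s \<in> L"
      and R: "lift (Suc j) ` N \<subseteq> L \<longrightarrow> (\<forall>Y. finite Y \<longrightarrow> card Y \<le> b \<longrightarrow>
         (\<exists>I c. (\<forall>g<m. I g \<subseteq> {..<n} - Y \<and> card (I g) \<le> ?p \<and> gadget N (w(Suc j := u)) (Suc j) (I g) (c g)) \<and>
               (\<forall>g<m. \<forall>g'<m. g \<noteq> g' \<longrightarrow> I g \<inter> I g' = {})))"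
      by (elim exE conjE) rule
    have U: "finite ?U" "card ?U \<le> b"
      using finY exceptional_subset(2) card_Un_le[of Y "exceptional n N w0 u"] cY X[OF u]
      by (auto simp: b_def)
    have "\<not> lift (Suc j) ` N \<subseteq> L"
    proof
      assume "lift (Suc j) ` N \<subseteq> L"
      from R[THEN mp, OF this, THEN spec, of ?U, THEN mp, OF U(1), THEN mp, OF U(2)]
      obtain I' c' where I'c': "\<forall>g<m. I' g \<subseteq> {..<n} - ?U \<and> card (I' g) \<le> ?p \<and> gadget N (w(Suc j := u)) (Suc j) (I' g) (c' g)"
          "\<forall>g<m. \<forall>g'<m. g \<noteq> g' \<longrightarrow> I' g \<inter> I' g' = {}"
        by (elim exE conjE) rule
      have I': "I' g \<subseteq> {..<n} - ?U \<and> card (I' g) \<le> ?p \<and> gadget N (w(Suc j := u)) (Suc j) (I' g) (c' g)" if "g < m" for g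
        using I'c'(1) that by blast
      have dis: "I' g \<inter> I' g' = {}" if "g < m" "g' < m" "g \<noteq> g'" for g g'
        using I'c'(2) that by blast
      have "ladder n N m q W w0 (Suc j) (w(Suc j := u)) (I(Suc j := I')) (c(Suc j := c'))"
      proof (rule ladder_extend[OF lad u])
        show "exceptional n N w0 (w l) \<subseteq> Y" if "l \<in> {1..j}" for l using that unfolding Y_def by blast
        show "I l g \<subseteq> Y" if "l \<in> {1..j}" "g < m" for l g using that unfolding Y_def by blast
        show "I' g \<subseteq> {..<n} - ?U \<and> card (I' g) \<le> q \<and> gadget N (w(Suc j := u)) (Suc j) (I' g) (c' g)"
          if "g < m" for g using I'[OF that] pq by linarith
      qed (use uY dis in auto)
      then show False using stuck by blast
    qed
    moreover have "card Z \<le> q * (b + m * q)"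
      using Z(2) pq by (meson add_left_mono le_trans mult_le_mono mult_le_mono2)
    ultimately show ?thesis using Z(1,3,4) by (intro exI[of _ Z] exI[of _ L]) simp
  qed
  then show ?thesis
    using Yn cY by (intro exI[of _ Y]) (auto simp: b_def)
qed

text \<open>
  The family is divided into boundedly many parts. Words meeting \<open>Y\<close> are sorted by their letters on \<open>Y\<close>; once
  these letters are copied into the centre, every word of the part has lost an exceptional coordinate. The others
  are sorted by their subgroup \<open>L\<close>; any word of such a part can serve as its new centre, with a smaller group in
  place of \<open>N\<close> at the price of a larger, but bounded, number of exceptional coordinates.
\<close>

lemma approximable_of_stuck_ladder:
  fixes b q \<zeta> r n A1 A2 j :: nat and \<epsilon> :: real
  assumes N: "subgroup N H" and w0: "w0 \<in> words n" and G: "\<G> \<subseteq> letter_conditions n"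
    and w: "\<And>l. l \<le> j \<Longrightarrow> w l \<in> words n"
    and X: "\<And>g. g \<in> \<G> \<Longrightarrow> card (exceptional n N w0 (fst g)) \<le> r"
    and Y: "Y \<subseteq> {..<n}" "card Y \<le> b"
    and alt: "\<forall>u\<in>fst ` \<G>. exceptional n N w0 u \<inter> Y \<noteq> {} \<or>
              (\<exists>Z L. Z \<subseteq> {..<n} \<and> card Z \<le> \<zeta> \<and> subgroup L (tuples (Suc j)) \<and>
                 (\<forall>i\<in>{..<n} - Z. \<forall>s\<in>S. column (Suc j) (w(Suc j := u)) i s \<in> L) \<and>
                 \<not> lift (Suc j) ` N \<subseteq> L)"
    and q: "order H ^ Suc (Suc j) \<le> q" and "0 \<le> \<epsilon>"
    and smaller_subgroup: "\<And>N' w0' \<G>'. subgroup N' H \<Longrightarrow> card N' < card N \<Longrightarrow> w0' \<in> words n \<Longrightarrow>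
         \<G>' \<subseteq> letter_conditions n \<Longrightarrow> (\<And>g. g \<in> \<G>' \<Longrightarrow> card (exceptional n N' w0' (fst g)) \<le> 2 * \<zeta> + 2 * r) \<Longrightarrow>
         approximable \<epsilon> A1 n \<G>'"
    and fewer_exceptions: "\<And>w0' \<G>'. w0' \<in> words n \<Longrightarrow> \<G>' \<subseteq> letter_conditions n \<Longrightarrow>
         (\<And>g. g \<in> \<G>' \<Longrightarrow> card (exceptional n N w0' (fst g)) < r) \<Longrightarrow> approximable \<epsilon> A2 n \<G>'"
  shows "approximable (real ((card M + 1) ^ b + 2 ^ q) * \<epsilon>) (((card M + 1) ^ b + 2 ^ q) * (A1 + A2)) n \<G>"
proof -
  let ?X = "exceptional n N w0" and ?P = "tuples (Suc j)"
  have Gw: "fst g \<in> words n" if "g \<in> \<G>" for g using G that by (auto simp: letter_conditions_def)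
  define good where "good u Z L \<longleftrightarrow> Z \<subseteq> {..<n} \<and> card Z \<le> \<zeta> \<and> subgroup L ?P \<and>
                 (\<forall>i\<in>{..<n} - Z. \<forall>s\<in>S. column (Suc j) (w(Suc j := u)) i s \<in> L) \<and>
                 \<not> lift (Suc j) ` N \<subseteq> L" for u Z L
  define LL where "LL u = (SOME L. \<exists>Z. good u Z L)" for u
  have LL: "\<exists>Z. good u Z (LL u)" if "u \<in> fst ` \<G>" "?X u \<inter> Y = {}" for u
  proof -
    have "?X u \<inter> Y \<noteq> {} \<or> (\<exists>Z L. good u Z L)" unfolding good_def using alt that(1) by (rule bspec)
    then have "\<exists>L Z. good u Z L" using that(2) by blast
    then show ?thesis unfolding LL_def by (rule someI_ex)
  qed
  define key where "key g = (if ?X (fst g) \<inter> Y = {} then Inr (LL (fst g)) else Inl (restrict (fst g) Y))" for g :: "(nat \<Rightarrow> 's \<Rightarrow> 'h) \<times> 'h set"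
  define K where "K = Inl ` (Y \<rightarrow>\<^sub>E M) \<union> Inr ` Pow (carrier ?P)"
  have finY: "finite Y" using Y(1) finite_subset by blast
  have finP: "finite (carrier ?P)" using finite_H by (auto simp: finite_PiE)
  have finK: "finite K" unfolding K_def using finY finite_M finP by (auto simp: finite_PiE)
  have cardK: "card K \<le> (card M + 1) ^ b + 2 ^ q"
  proof -
    have "card K \<le> card (Inl ` (Y \<rightarrow>\<^sub>E M) :: ((nat \<Rightarrow> 's \<Rightarrow> 'h) + (nat \<Rightarrow> 'h) set) set)
        + card (Inr ` Pow (carrier ?P) :: ((nat \<Rightarrow> 's \<Rightarrow> 'h) + (nat \<Rightarrow> 'h) set) set)"
      unfolding K_def by (rule card_Un_le)
    also have "\<dots> = card (Y \<rightarrow>\<^sub>E M) + card (Pow (carrier ?P))"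
      by (simp only: card_image inj_Inl inj_Inr)
    also have "card (Pow (carrier ?P)) = 2 ^ (order ?P)"
      unfolding order_def using finP by (rule card_Pow)
    also have "\<dots> \<le> 2 ^ q" using q unfolding order_tuples by (intro power_increasing) auto
    also have "card (Y \<rightarrow>\<^sub>E M) \<le> (card M + 1) ^ b"
    proof -
      have "card (Y \<rightarrow>\<^sub>E M) = card M ^ card Y" using finY by (simp add: card_PiE)
      also have "\<dots> \<le> (card M + 1) ^ card Y" by (intro power_mono) auto
      also have "\<dots> \<le> (card M + 1) ^ b" using Y(2) by (intro power_increasing) auto
      finally show ?thesis .
    qed
    finally show ?thesis by simp
  qed
  have keyK: "key g \<in> K" if g: "g \<in> \<G>" for g
  proof (cases "?X (fst g) \<inter> Y = {}")
    case True
    then obtain Z where "good (fst g) Z (LL (fst g))" using LL[of "fst g"] g by blast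
    then have "subgroup (LL (fst g)) ?P" unfolding good_def by (elim conjE)
    then have "LL (fst g) \<subseteq> carrier ?P" by (rule subgroup.subset)
    then show ?thesis using True by (simp add: key_def K_def del: carrier_product_group)
  next
    case False
    have "restrict (fst g) Y \<in> Y \<rightarrow>\<^sub>E M" using Gw[OF g] Y(1) by (auto simp: words_def)
    then show ?thesis using False by (simp add: key_def K_def)
  qed
  have each: "approximable \<epsilon> (A1 + A2) n {g \<in> \<G>. key g = \<kappa>}" if \<kappa>: "\<kappa> \<in> K" for \<kappa>
  proof (cases "{g \<in> \<G>. key g = \<kappa>} = {}")
    case True
    show ?thesis unfolding True using \<open>0 \<le> \<epsilon>\<close> by (rule approximable_empty)
  next
    case False
    let ?G = "{g \<in> \<G>. key g = \<kappa>}"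
    have G': "?G \<subseteq> letter_conditions n" using G by blast
    show ?thesis
    proof (cases \<kappa>)
      case (Inl f)
      have f: "f \<in> Y \<rightarrow>\<^sub>E M" using \<kappa> Inl by (auto simp: K_def)
      have kg: "?X (fst g) \<inter> Y \<noteq> {}" "restrict (fst g) Y = f" if "g \<in> ?G" for g
        using that Inl by (auto simp: key_def split: if_splits)
      let ?w = "override_on w0 f Y"
      have "approximable \<epsilon> A2 n ?G"
      proof (rule fewer_exceptions[OF _ G'])
        show "?w \<in> words n" using w0 f by (auto simp: words_def override_on_def)
        fix g assume g: "g \<in> ?G"
        have gw: "fst g \<in> words n" using Gw g by blast
        have "exceptional n N ?w (fst g) \<subseteq> ?X (fst g) - Y"
        proof
          fix i assume i: "i \<in> exceptional n N ?w (fst g)"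
          then obtain s where s: "i < n" "s \<in> S" "quot ?w (fst g) i s \<notin> N" by (auto simp: exceptional_def)
          have "i \<notin> Y"
          proof
            assume "i \<in> Y"
            then have "?w i = fst g i" using kg(2)[OF g] by auto
            then have "quot ?w (fst g) i s = \<one>" using words_closed[OF gw s(1,2)] by (simp add: quot_def)
            then show False using s(3) subgroup.one_closed[OF N] by simp
          qed
          then show "i \<in> ?X (fst g) - Y" using s by (auto simp: exceptional_def quot_def)
        qed
        then have "exceptional n N ?w (fst g) \<subset> ?X (fst g)" using kg(1)[OF g] by blast
        then have "card (exceptional n N ?w (fst g)) < card (?X (fst g))"
          using exceptional_subset(2) by (intro psubset_card_mono)
        then show "card (exceptional n N ?w (fst g)) < r" using X[of g] g by auto
      qed
      then show ?thesis by (rule approximable_mono) auto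
    next
      case (Inr L)
      have kg: "?X (fst g) \<inter> Y = {}" "LL (fst g) = L" if "g \<in> ?G" for g
        using that Inr by (auto simp: key_def split: if_splits)
      have ZL: "\<exists>Z. good (fst g) Z L" if g: "g \<in> ?G" for g
      proof -
        have "\<exists>Z. good (fst g) Z (LL (fst g))" using g kg(1)[OF g] by (intro LL) auto
        then show ?thesis unfolding kg(2)[OF g] .
      qed
      obtain g0 where g0: "g0 \<in> ?G" using False by blast
      obtain Z0 where Z0: "Z0 \<subseteq> {..<n}" "card Z0 \<le> \<zeta>" "subgroup L ?P"
        "\<forall>i\<in>{..<n} - Z0. \<forall>s\<in>S. column (Suc j) (w(Suc j := fst g0)) i s \<in> L"
        "\<not> lift (Suc j) ` N \<subseteq> L" using ZL[OF g0] unfolding good_def by (elim exE conjE) rule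
      let ?N = "{h \<in> N. lift (Suc j) h \<in> L}"
      have "approximable \<epsilon> A1 n ?G"
      proof (rule smaller_subgroup[OF _ _ _ G'])
        show "subgroup ?N H" using N Z0(3) by (rule subgroup_lift_preimage)
        have "finite N" using N finite_H subgroup.subset finite_subset by blast
        then show "card ?N < card N" using Z0(5) by (intro psubset_card_mono) auto
        show "fst g0 \<in> words n" using Gw g0 by blast
        fix g assume g: "g \<in> ?G"
        obtain Z where Z: "Z \<subseteq> {..<n}" "card Z \<le> \<zeta>"
          "\<forall>i\<in>{..<n} - Z. \<forall>s\<in>S. column (Suc j) (w(Suc j := fst g)) i s \<in> L" using ZL[OF g] unfolding good_def by (elim exE conjE) rule
        let ?U = "Z0 \<union> Z \<union> ?X (fst g0) \<union> ?X (fst g)"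
        have "exceptional n ?N (fst g0) (fst g) \<subseteq> ?U"
          using g0 g w Gw by (intro exceptional_of_common_subgroup[OF N Z0(3) _ w0 _ _ Z0(4) Z(3)]) auto
        moreover have "finite ?U"
          using Z0(1) Z(1) finite_subset[of _ "{..<n}"] exceptional_subset(2) by auto
        ultimately have "card (exceptional n ?N (fst g0) (fst g)) \<le> card ?U" by (rule card_mono[rotated])
        also have "\<dots> \<le> card Z0 + card Z + card (?X (fst g0)) + card (?X (fst g))"
          using card_Un_le[of Z0 Z] card_Un_le[of "Z0 \<union> Z" "?X (fst g0)"]
            card_Un_le[of "Z0 \<union> Z \<union> ?X (fst g0)" "?X (fst g)"] by linarith
        also have "\<dots> \<le> 2 * \<zeta> + 2 * r" using Z0(2) Z(2) X[of g0] X[of g] g0 g by auto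
        finally show "card (exceptional n ?N (fst g0) (fst g)) \<le> 2 * \<zeta> + 2 * r" .
      qed
      then show ?thesis by (rule approximable_mono) auto
    qed
  qed
  show ?thesis by (rule approximable_by_cases[OF finK cardK keyK \<open>0 \<le> \<epsilon>\<close> each])
qed

end

section \<open>The induction\<close>

context letter_system
begin

text \<open>
  The bound \<open>A\<close> may depend on the size of \<open>N\<close> and on the number of exceptional coordinates, but not on \<open>n\<close>,
  \<open>N\<close>, the centre or the family. The strict inequality makes \<open>r = 0\<close> the case of an empty family.
\<close>

definition uniformly_approximable :: "nat \<Rightarrow> nat \<Rightarrow> real \<Rightarrow> nat \<Rightarrow> bool" where
  "uniformly_approximable k r \<epsilon> A \<longleftrightarrow>
     (\<forall>n N w0 \<G>. subgroup N H \<longrightarrow> card N \<le> k \<longrightarrow> w0 \<in> words n \<longrightarrow> \<G> \<subseteq> letter_conditions n \<longrightarrow>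
        (\<forall>g\<in>\<G>. card (exceptional n N w0 (fst g)) < r) \<longrightarrow> approximable \<epsilon> A n \<G>)"

lemma uniformly_approximableD:
  assumes "uniformly_approximable k r \<epsilon> A" "subgroup N H" "card N \<le> k" "w0 \<in> words n"
    "\<G> \<subseteq> letter_conditions n" "\<And>g. g \<in> \<G> \<Longrightarrow> card (exceptional n N w0 (fst g)) < r"
  shows "approximable \<epsilon> A n \<G>"
  using assms unfolding uniformly_approximable_def by blast

text \<open>
  The number of exceptional coordinates is allowed to grow when \<open>N\<close> shrinks, whence the lexicographic
  induction.
\<close>

lemma uniformly_approximable_step:
  fixes \<epsilon> :: real
  assumes smaller: "\<And>r \<epsilon>. 0 < \<epsilon> \<Longrightarrow> \<exists>A. uniformly_approximable k r \<epsilon> A"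
    and fewer: "\<And>\<epsilon>. 0 < \<epsilon> \<Longrightarrow> \<exists>A. uniformly_approximable (Suc k) r \<epsilon> A"
    and "0 < \<epsilon>"
  shows "\<exists>A. uniformly_approximable (Suc k) (Suc r) \<epsilon> A"
proof -
  let ?\<eta> = "real (order H)" and ?\<sigma> = "real (card S)"
  \<comment> \<open>The number of pairs \<open>(E, T)\<close>, where \<open>T\<close> collects the values of the exceptional part.\<close>
  define k1 :: nat where "k1 = 2 ^ order H * 2 ^ order H"
  define \<epsilon>1 where "\<epsilon>1 = \<epsilon> / real k1"
  have k1: "0 < k1" unfolding k1_def by simp
  have \<epsilon>1: "0 < \<epsilon>1" using \<open>0 < \<epsilon>\<close> k1 by (simp add: \<epsilon>1_def)
  have \<eta>: "1 \<le> ?\<eta>" using order_pos by simp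
  have \<sigma>: "1 \<le> ?\<sigma>" using finite_S s0 by (auto simp: Suc_le_eq card_gt_0_iff)
  \<comment> \<open>First the height \<open>d\<close>, which determines the size \<open>q\<close> of the gadgets, and only then their number \<open>m\<close>.\<close>
  have "0 < \<epsilon>1 / (2 * ?\<eta>)" "1 - 1 / ((?\<eta> + 1) * ?\<sigma> ^ r) < 1"
    using \<epsilon>1 \<eta> \<sigma> by (auto intro!: divide_pos_pos mult_pos_pos zero_less_power)
  then obtain d where d: "(1 - 1 / ((?\<eta> + 1) * ?\<sigma> ^ r)) ^ d < \<epsilon>1 / (2 * ?\<eta>)"
    using real_arch_pow_inv by blast
  define q where "q = order H ^ Suc d"
  have "0 < \<epsilon>1 / (2 * ?\<eta> * (real d + 1))" "1 - 1 / ?\<sigma> ^ q < 1"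
    using \<epsilon>1 \<eta> \<sigma> by (auto intro!: divide_pos_pos mult_pos_pos zero_less_power)
  then obtain m where m: "(1 - 1 / ?\<sigma> ^ q) ^ m < \<epsilon>1 / (2 * ?\<eta> * (real d + 1))"
    using real_arch_pow_inv by blast
  have loss: "?\<eta> * ((1 - 1 / ((?\<eta> + 1) * ?\<sigma> ^ r)) ^ d + real d * (1 - 1 / ?\<sigma> ^ q) ^ m) \<le> \<epsilon>1"
  proof -
    have "real d * (1 - 1 / ?\<sigma> ^ q) ^ m \<le> real d * (\<epsilon>1 / (2 * ?\<eta> * (real d + 1)))"
      using m by (intro mult_left_mono) auto
    also have "\<dots> = real d / (real d + 1) * (\<epsilon>1 / (2 * ?\<eta>))" by simp
    also have "\<dots> \<le> 1 * (\<epsilon>1 / (2 * ?\<eta>))"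
      using \<epsilon>1 \<eta> by (intro mult_right_mono) auto
    finally have "(1 - 1 / ((?\<eta> + 1) * ?\<sigma> ^ r)) ^ d + real d * (1 - 1 / ?\<sigma> ^ q) ^ m \<le> \<epsilon>1 / (2 * ?\<eta>) + \<epsilon>1 / (2 * ?\<eta>)"
      using d by simp
    also have "\<dots> = \<epsilon>1 / ?\<eta>" by simp
    finally show ?thesis using \<eta> by (simp add: pos_le_divide_eq mult.commute)
  qed
  \<comment> \<open>\<open>b\<close> bounds the coordinates used by a ladder and one more word, \<open>\<zeta>\<close> the size of the sets \<open>Z\<close>,
     and \<open>k2\<close> the number of parts into which a stuck ladder divides the family.\<close>
  define b where "b = d * (r + m * q) + r"
  define \<zeta> where "\<zeta> = q * (b + m * q)"
  define k2 where "k2 = (card M + 1) ^ b + 2 ^ q"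
  define \<epsilon>2 where "\<epsilon>2 = \<epsilon>1 / real k2"
  have k2: "0 < k2" unfolding k2_def by simp
  have \<epsilon>2: "0 < \<epsilon>2" using \<epsilon>1 k2 by (simp add: \<epsilon>2_def)
  obtain A1 where A1: "uniformly_approximable k (Suc (2 * \<zeta> + 2 * r)) \<epsilon>2 A1" using smaller[OF \<epsilon>2] by blast
  obtain A2 where A2: "uniformly_approximable (Suc k) r \<epsilon>2 A2" using fewer[OF \<epsilon>2] by blast
  define A where "A = k2 * (A1 + A2) + 1"
  have "approximable \<epsilon> (k1 * A) n \<G>"
    if N: "subgroup N H" "card N \<le> Suc k" and w0: "w0 \<in> words n" and G: "\<G> \<subseteq> letter_conditions n"
      and X: "\<And>g. g \<in> \<G> \<Longrightarrow> card (exceptional n N w0 (fst g)) < Suc r" for n N w0 \<G>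
  proof -
    define T where "T g = reach (quot w0 (fst g)) S (exceptional n N w0 (fst g))" for g :: "(nat \<Rightarrow> 's \<Rightarrow> 'h) \<times> 'h set"
    have T: "T g \<subseteq> carrier H" if "g \<in> \<G>" for g
      unfolding T_def using G that w0
      by (intro reach_subset_carrier quot_closed) (auto simp: letter_conditions_def exceptional_def)
    have "approximable (real k1 * \<epsilon>1) (k1 * A) n \<G>"
    proof (rule approximable_by_cases[where K="Pow (carrier H) \<times> Pow (carrier H)" and key="\<lambda>g. (snd g, T g)"])
      show "finite (Pow (carrier H) \<times> Pow (carrier H))" using finite_H by simp
      show "card (Pow (carrier H) \<times> Pow (carrier H)) \<le> k1"
        using finite_H by (simp add: k1_def order_def card_cartesian_product card_Pow)
      show "(snd g, T g) \<in> Pow (carrier H) \<times> Pow (carrier H)" if "g \<in> \<G>" for g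
        using T[OF that] subsetD[OF G that] by (auto simp: letter_conditions_def mem_Times_iff)
      show "0 \<le> \<epsilon>1" using \<epsilon>1 by simp
    next
      fix \<kappa> assume \<kappa>: "\<kappa> \<in> Pow (carrier H) \<times> Pow (carrier H)"
      let ?G = "{g \<in> \<G>. (snd g, T g) = \<kappa>}"
      have G': "?G \<subseteq> letter_conditions n" using G by blast
      then have W: "fst ` ?G \<subseteq> words n" by (auto simp: letter_conditions_def)
      have X': "card (exceptional n N w0 (fst g)) \<le> r" if "g \<in> ?G" for g using X[of g] that by simp
      consider w I c where "ladder n N m q (fst ` ?G) w0 d w I c"
        | j w I c where "j < d" "ladder n N m q (fst ` ?G) w0 j w I c"
            "\<not> (\<exists>w I c. ladder n N m q (fst ` ?G) w0 (Suc j) w I c)"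
        using maximal_ladder[of n N m q "fst ` ?G" w0 d] by blast
      then show "approximable \<epsilon>1 A n ?G"
      proof cases
        case (1 w I c)
        have "approximable (?\<eta> * ((1 - 1 / ((?\<eta> + 1) * ?\<sigma> ^ r)) ^ d + real d * (1 - 1 / ?\<sigma> ^ q) ^ m)) 1 n ?G"
          using \<kappa> by (intro approximable_of_ladder[OF N(1) w0 G' _ X' _ _ 1, of "fst \<kappa>" "snd \<kappa>"]) (auto simp: T_def)
        then show ?thesis using loss by (rule approximable_mono) (simp add: A_def)
      next
        case (2 j w I c)
        have X'': "\<forall>u\<in>fst ` ?G. card (exceptional n N w0 u) \<le> r" using X' by blast
        obtain Y where Y: "Y \<subseteq> {..<n}" "card Y \<le> b"
          and alt: "\<forall>u\<in>fst ` ?G. exceptional n N w0 u \<inter> Y \<noteq> {} \<or>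
              (\<exists>Z L. Z \<subseteq> {..<n} \<and> card Z \<le> \<zeta> \<and> subgroup L (tuples (Suc j)) \<and>
                 (\<forall>i\<in>{..<n} - Z. \<forall>s\<in>S. column (Suc j) (w(Suc j := u)) i s \<in> L) \<and>
                 \<not> lift (Suc j) ` N \<subseteq> L)"
          using stuck_ladder[OF 2(2)[unfolded q_def] 2(1) 2(3)[unfolded q_def] W w0 X'']
          unfolding q_def[symmetric] b_def[symmetric] \<zeta>_def[symmetric] by (elim exE conjE) rule
        have wl: "w l \<in> words n" if "l \<le> j" for l
          using 2(2) W w0 that by (cases "l = 0") (auto simp: ladder_def)
        have q: "order H ^ Suc (Suc j) \<le> q"
          unfolding q_def using 2(1) order_pos by (intro power_increasing) auto
        have "approximable (real k2 * \<epsilon>2) (k2 * (A1 + A2)) n ?G"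
          unfolding k2_def
        proof (rule approximable_of_stuck_ladder[OF N(1) w0 G' wl X' Y alt q])
          show "0 \<le> \<epsilon>2" using \<epsilon>2 by simp
          show "approximable \<epsilon>2 A1 n \<G>'"
            if "subgroup N' H" "card N' < card N" "w0' \<in> words n" "\<G>' \<subseteq> letter_conditions n"
              "\<And>g. g \<in> \<G>' \<Longrightarrow> card (exceptional n N' w0' (fst g)) \<le> 2 * \<zeta> + 2 * r" for N' w0' \<G>'
            using that N(2) by (intro uniformly_approximableD[OF A1, of N' w0']) (auto simp: less_Suc_eq_le)
          show "approximable \<epsilon>2 A2 n \<G>'"
            if "w0' \<in> words n" "\<G>' \<subseteq> letter_conditions n"
              "\<And>g. g \<in> \<G>' \<Longrightarrow> card (exceptional n N w0' (fst g)) < r" for w0' \<G>'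
            using that N by (intro uniformly_approximableD[OF A2, of N w0'])
        qed
        moreover have "real k2 * \<epsilon>2 = \<epsilon>1" using k2 by (simp add: \<epsilon>2_def)
        ultimately have "approximable \<epsilon>1 (k2 * (A1 + A2)) n ?G" by (simp only:)
        then show ?thesis by (rule approximable_mono) (auto simp: A_def)
      qed
    qed
    moreover have "real k1 * \<epsilon>1 = \<epsilon>" using k1 by (simp add: \<epsilon>1_def)
    ultimately show ?thesis by simp
  qed
  then show ?thesis
    unfolding uniformly_approximable_def by (intro exI[of _ "k1 * A"] allI impI) simp
qed

lemma uniformly_approximable: "0 < \<epsilon> \<Longrightarrow> \<exists>A. uniformly_approximable k r \<epsilon> A"
proof (induction k arbitrary: r \<epsilon>)
  case 0
  have "\<not> card N \<le> 0" if "subgroup N H" for N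
    using that subgroup.one_closed[OF that] finite_subset[OF subgroup.subset[OF that] finite_H] by auto
  then show ?case unfolding uniformly_approximable_def by blast
next
  case (Suc k)
  note smaller = Suc.IH
  show ?case
    using Suc.prems
  proof (induction r arbitrary: \<epsilon>)
    case 0
    have "approximable \<epsilon> 0 n \<G>" if "\<forall>g\<in>\<G>. card (exceptional n N w0 (fst g)) < 0" for n N w0 \<G>
    proof -
      have "\<G> = {}" using that by auto
      then show ?thesis using approximable_empty[of \<epsilon> 0 n] \<open>0 < \<epsilon>\<close> by simp
    qed
    then show ?case unfolding uniformly_approximable_def by blast
  next
    case (Suc r)
    show ?case by (rule uniformly_approximable_step[OF smaller Suc.IH Suc.prems])
  qed
qed

text \<open>
  With \<open>N\<close> the whole group no coordinate is exceptional, so every family is admissible with any of its words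
  as centre.
\<close>

theorem letter_conditions_approximable:
  assumes "0 < \<epsilon>"
  shows "\<exists>A. \<forall>n \<G>. \<G> \<subseteq> letter_conditions n \<longrightarrow> approximable \<epsilon> A n \<G>"
proof -
  obtain A where A: "uniformly_approximable (order H) 1 \<epsilon> A" using uniformly_approximable[OF assms] by blast
  have "approximable \<epsilon> A n \<G>" if G: "\<G> \<subseteq> letter_conditions n" for n \<G>
  proof (cases "\<G> = {}")
    case True then show ?thesis using assms approximable_empty[of \<epsilon> A n] by simp
  next
    case False
    then obtain g0 where "g0 \<in> \<G>" by blast
    then have w0: "fst g0 \<in> words n" using G by (auto simp: letter_conditions_def)
    have "exceptional n (carrier H) (fst g0) (fst g) = {}" if "g \<in> \<G>" for g
      using quot_closed[OF w0, of "fst g"] G that by (auto simp: exceptional_def letter_conditions_def)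
    then show ?thesis
      using subgroup_self w0 G by (intro uniformly_approximableD[OF A, of "carrier H" "fst g0"]) (auto simp: order_def)
  qed
  then show ?thesis by blast
qed

end

section \<open>Homomorphisms on powers\<close>

definition unit_point :: "('a, 'b) monoid_scheme \<Rightarrow> nat \<Rightarrow> nat \<Rightarrow> 'a \<Rightarrow> nat \<Rightarrow> 'a" where
  "unit_point G n i a = (\<lambda>j\<in>{..<n}. if j = i then a else \<one>\<^bsub>G\<^esub>)"

lemma carrier_group_power: "carrier (group_power G n) = ({..<n} \<rightarrow>\<^sub>E carrier G)"
  by (simp add: group_power_def)

lemma mult_group_power: "x \<otimes>\<^bsub>group_power G n\<^esub> y = (\<lambda>i\<in>{..<n}. x i \<otimes>\<^bsub>G\<^esub> y i)"
  by (simp add: group_power_def)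

lemma unit_point_closed: "group G \<Longrightarrow> a \<in> carrier G \<Longrightarrow> unit_point G n i a \<in> carrier (group_power G n)"
  by (auto simp: unit_point_def carrier_group_power group.is_monoid monoid.one_closed)

lemma hom_unit_point:
  assumes "group G" "\<phi> \<in> hom (group_power G n) H"
  shows "(\<lambda>a. \<phi> (unit_point G n i a)) \<in> hom G H"
proof (rule homI)
  interpret G: group G by fact
  show "\<phi> (unit_point G n i a) \<in> carrier H" if "a \<in> carrier G" for a
    using assms that by (intro hom_in_carrier[OF assms(2)] unit_point_closed)
  show "\<phi> (unit_point G n i (a \<otimes>\<^bsub>G\<^esub> a')) = \<phi> (unit_point G n i a) \<otimes>\<^bsub>H\<^esub> \<phi> (unit_point G n i a')"
    if "a \<in> carrier G" "a' \<in> carrier G" for a a'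
  proof -
    have "unit_point G n i (a \<otimes>\<^bsub>G\<^esub> a') = unit_point G n i a \<otimes>\<^bsub>group_power G n\<^esub> unit_point G n i a'"
      using that by (auto simp: unit_point_def mult_group_power)
    then show ?thesis using hom_mult[OF assms(2)] unit_point_closed[OF assms(1)] that by metis
  qed
qed

text \<open>
  This turns a homomorphism into a word; the coordinates of \<open>x\<close> are filled in one at a time.
\<close>

lemma hom_group_power_eq:
  assumes "comm_group G" "comm_group H" "\<phi> \<in> hom (group_power G n) H" "x \<in> carrier (group_power G n)"
  shows "\<phi> x = finprod H (\<lambda>i. \<phi> (unit_point G n i (x i))) {..<n}"
proof -
  interpret G: comm_group G by fact
  interpret H: comm_group H by fact
  have P: "group (group_power G n)" unfolding group_power_def using G.is_group by simp
  have x: "x i \<in> carrier G" if "i < n" for i using assms(4) that by (auto simp: carrier_group_power)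
  have "\<phi> (\<lambda>j\<in>{..<n}. if j < k then x j else \<one>\<^bsub>G\<^esub>) = finprod H (\<lambda>i. \<phi> (unit_point G n i (x i))) {..<k}"
    if "k \<le> n" for k
    using that
  proof (induction k)
    case 0
    have "(\<lambda>j\<in>{..<n}. \<one>\<^bsub>G\<^esub>) = \<one>\<^bsub>group_power G n\<^esub>" by (simp add: group_power_def)
    then show ?case using hom_one[OF assms(3) P H.is_group] by simp
  next
    case (Suc k)
    let ?y = "\<lambda>j\<in>{..<n}. if j < k then x j else \<one>\<^bsub>G\<^esub>" and ?e = "unit_point G n k (x k)"
    have y: "?y \<in> carrier (group_power G n)" using x by (auto simp: carrier_group_power)
    have e: "?e \<in> carrier (group_power G n)" using x Suc.prems by (intro unit_point_closed) auto
    have "(\<lambda>j\<in>{..<n}. if j < Suc k then x j else \<one>\<^bsub>G\<^esub>) = ?e \<otimes>\<^bsub>group_power G n\<^esub> ?y"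
      using x by (auto simp: mult_group_power unit_point_def less_Suc_eq intro!: restrict_ext)
    then have "\<phi> (\<lambda>j\<in>{..<n}. if j < Suc k then x j else \<one>\<^bsub>G\<^esub>) = \<phi> ?e \<otimes>\<^bsub>H\<^esub> \<phi> ?y"
      using hom_mult[OF assms(3) e y] by simp
    also have "\<phi> ?y = finprod H (\<lambda>i. \<phi> (unit_point G n i (x i))) {..<k}"
      using Suc.prems by (intro Suc.IH) simp
    also have "\<phi> ?e \<otimes>\<^bsub>H\<^esub> finprod H (\<lambda>i. \<phi> (unit_point G n i (x i))) {..<k}
        = finprod H (\<lambda>i. \<phi> (unit_point G n i (x i))) (insert k {..<k})"
      using x Suc.prems hom_in_carrier[OF assms(3)] unit_point_closed[OF G.is_group]
      by (intro H.finprod_insert[symmetric]) auto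
    finally show ?case by (simp add: lessThan_Suc)
  qed
  from this[of n] have "\<phi> (\<lambda>j\<in>{..<n}. if j < n then x j else \<one>\<^bsub>G\<^esub>) = finprod H (\<lambda>i. \<phi> (unit_point G n i (x i))) {..<n}"
    by simp
  moreover have "(\<lambda>j\<in>{..<n}. if j < n then x j else \<one>\<^bsub>G\<^esub>) = x"
    using assms(4) by (auto simp: carrier_group_power PiE_iff extensional_def)
  ultimately show ?thesis by simp
qed

lemma ex_hom_group_power:
  assumes "comm_group G" "comm_group H" and f: "\<And>i. i < n \<Longrightarrow> f i \<in> hom G H"
  shows "\<exists>\<psi>. \<psi> \<in> hom (group_power G n) H \<and> \<psi> \<in> extensional (carrier (group_power G n)) \<and>
           (\<forall>i<n. \<forall>a\<in>carrier G. \<psi> (unit_point G n i a) = f i a)"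
proof -
  interpret G: comm_group G by fact
  interpret H: comm_group H by fact
  let ?C = "carrier (group_power G n)"
  define \<psi> where "\<psi> = (\<lambda>x\<in>?C. finprod H (\<lambda>i. f i (x i)) {..<n})"
  have fx: "f i (x i) \<in> carrier H" if "i < n" "x \<in> ?C" for i x
    using hom_in_carrier[OF f] that by (auto simp: carrier_group_power)
  have "\<psi> \<in> hom (group_power G n) H"
  proof (rule homI)
    show "\<psi> x \<in> carrier H" if "x \<in> ?C" for x
      using that fx by (auto simp: \<psi>_def intro!: H.finprod_closed)
    show "\<psi> (x \<otimes>\<^bsub>group_power G n\<^esub> y) = \<psi> x \<otimes>\<^bsub>H\<^esub> \<psi> y" if xy: "x \<in> ?C" "y \<in> ?C" for x y
    proof -
      have xyC: "x \<otimes>\<^bsub>group_power G n\<^esub> y \<in> ?C"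
        using xy by (auto simp: mult_group_power carrier_group_power)
      have "\<psi> (x \<otimes>\<^bsub>group_power G n\<^esub> y) = finprod H (\<lambda>i. f i ((x \<otimes>\<^bsub>group_power G n\<^esub> y) i)) {..<n}"
        using xyC by (simp add: \<psi>_def)
      also have "\<dots> = finprod H (\<lambda>i. f i (x i) \<otimes>\<^bsub>H\<^esub> f i (y i)) {..<n}"
      proof (rule H.finprod_cong')
        show "f i ((x \<otimes>\<^bsub>group_power G n\<^esub> y) i) = f i (x i) \<otimes>\<^bsub>H\<^esub> f i (y i)" if "i \<in> {..<n}" for i
          using xy that hom_mult[OF f, of i "x i" "y i"] by (auto simp: mult_group_power carrier_group_power)
      qed (use fx xy in auto)
      also have "\<dots> = \<psi> x \<otimes>\<^bsub>H\<^esub> \<psi> y"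
        using xy fx by (simp add: \<psi>_def H.finprod_multf Pi_iff)
      finally show ?thesis .
    qed
  qed
  moreover have "\<psi> (unit_point G n i a) = f i a" if i: "i < n" "a \<in> carrier G" for i a
  proof -
    have one: "f j \<one>\<^bsub>G\<^esub> = \<one>\<^bsub>H\<^esub>" if "j < n" for j
      using hom_one[OF f[OF that] G.is_group H.is_group] .
    have "\<psi> (unit_point G n i a) = finprod H (\<lambda>j. f j (unit_point G n i a j)) {..<n}"
      using unit_point_closed[OF G.is_group i(2)] by (simp add: \<psi>_def)
    also have "\<dots> = finprod H (\<lambda>j. if i = j then f j a else \<one>\<^bsub>H\<^esub>) {..<n}"
      using one i hom_in_carrier[OF f] by (intro H.finprod_cong') (auto simp: unit_point_def)
    also have "\<dots> = f i a"
      using i hom_in_carrier[OF f] by (intro H.finprod_singleton) auto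
    finally show ?thesis .
  qed
  ultimately show ?thesis by (intro exI[of _ \<psi>]) (auto simp: \<psi>_def)
qed

theorem theorem1p4:
  fixes G :: "('a, 'b) monoid_scheme" and H :: "('h, 'c) monoid_scheme"
    and S :: "'a set" and \<epsilon> :: real
  assumes "comm_group G" and "finite (carrier G)"
    and "comm_group H" and "finite (carrier H)"
    and "S \<subseteq> carrier G" and "S \<noteq> {}"
    and "\<epsilon> > 0"
  shows "\<exists>A::nat. \<forall>n\<ge>1. \<forall>\<G>. \<G> \<subseteq> conditions G n H \<longrightarrow>
           (\<exists>\<F>. \<F> \<subseteq> conditions G n H \<and> finite \<F> \<and> card \<F> \<le> A \<and>
                internally_approximates \<epsilon> S n \<F> \<G>)"
proof -
  interpret G: comm_group G by fact
  interpret H: comm_group H by fact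
  obtain s0 where s0: "s0 \<in> S" using \<open>S \<noteq> {}\<close> by blast
  define norm where "norm f = (\<lambda>s\<in>S. f s \<otimes>\<^bsub>H\<^esub> inv\<^bsub>H\<^esub> f s0)" for f
  define M where "M = norm ` hom G H"
  have SG: "s \<in> carrier G" if "s \<in> S" for s using that \<open>S \<subseteq> carrier G\<close> by blast
  have finS: "finite S" using \<open>S \<subseteq> carrier G\<close> \<open>finite (carrier G)\<close> by (rule finite_subset)
  have M: "M \<subseteq> S \<rightarrow>\<^sub>E carrier H"
    unfolding M_def norm_def using hom_in_carrier[of _ G H] SG s0 by auto
  then have finM: "finite M"
    using finS \<open>finite (carrier H)\<close> finite_PiE finite_subset by (metis (mono_tags, lifting))
  interpret letter_system H S s0 M
  proof unfold_locales
    show "finite (carrier H)" "finite S" "s0 \<in> S" "finite M" by fact+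
    show "\<mu> s \<in> carrier H" if "\<mu> \<in> M" "s \<in> S" for \<mu> s using that M by blast
    show "\<mu> s0 = \<one>\<^bsub>H\<^esub>" if "\<mu> \<in> M" for \<mu>
      using that hom_in_carrier[of _ G H s0] SG s0 by (auto simp: M_def norm_def)
  qed
  obtain A where A: "\<And>n \<G>. \<G> \<subseteq> letter_conditions n \<Longrightarrow> approximable \<epsilon> A n \<G>"
    using letter_conditions_approximable[OF \<open>\<epsilon> > 0\<close>] by blast
  have "\<exists>\<F>. \<F> \<subseteq> conditions G n H \<and> finite \<F> \<and> card \<F> \<le> A \<and> internally_approximates \<epsilon> S n \<F> \<G>"
    if GC: "\<G> \<subseteq> conditions G n H" for n \<G>
  proof -
    let ?O = "set_power S n" and ?P = "group_power G n"
    \<comment> \<open>On \<open>S\<^sup>n\<close> a homomorphism is its word times its value \<open>\<kappa>\<close> at the constant point \<open>s0\<close>. Dividing \<open>E\<close>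
       by \<open>\<kappa>\<close> encodes a condition, multiplying by it decodes.\<close>
    define word where "word \<phi> i = norm (\<lambda>a. \<phi> (unit_point G n i a))" for \<phi> :: "(nat \<Rightarrow> 'a) \<Rightarrow> 'h" and i
    define \<kappa> where "\<kappa> \<phi> = \<phi> (\<lambda>i\<in>{..<n}. s0)" for \<phi> :: "(nat \<Rightarrow> 'a) \<Rightarrow> 'h"
    have base: "(\<lambda>i\<in>{..<n}. s0) \<in> carrier ?P" using SG s0 by (auto simp: carrier_group_power)
    have \<kappa>: "\<kappa> \<phi> \<in> carrier H" if "\<phi> \<in> hom ?P H" for \<phi>
      unfolding \<kappa>_def using hom_in_carrier[OF that base] .
    have OP: "x \<in> carrier ?P" if "x \<in> ?O" for x
      using that SG by (auto simp: set_power_def carrier_group_power)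
    have word: "word \<phi> \<in> words n" if "\<phi> \<in> hom ?P H" for \<phi>
    proof -
      have "word \<phi> i \<in> M" for i
        unfolding word_def M_def using hom_unit_point[OF G.is_group that] by (rule imageI)
      then show ?thesis by (simp add: words_def)
    qed
    have split: "\<phi> x = \<kappa> \<phi> \<otimes>\<^bsub>H\<^esub> part (word \<phi>) {..<n} x" if \<phi>: "\<phi> \<in> hom ?P H" and x: "x \<in> ?O" for \<phi> x
    proof -
      let ?u = "\<lambda>i a. \<phi> (unit_point G n i a)"
      have u: "?u i a \<in> carrier H" if "a \<in> carrier G" for i a
        using hom_in_carrier[OF hom_unit_point[OF G.is_group \<phi>] that] .
      have xi: "x i \<in> S" if "i < n" for i using set_powerD[OF x that] .
      have "\<kappa> \<phi> = finprod H (\<lambda>i. ?u i ((\<lambda>i\<in>{..<n}. s0) i)) {..<n}"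
        unfolding \<kappa>_def by (rule hom_group_power_eq[OF \<open>comm_group G\<close> \<open>comm_group H\<close> \<phi> base])
      also have "\<dots> = finprod H (\<lambda>i. ?u i s0) {..<n}"
        using u SG s0 by (intro H.finprod_cong') auto
      finally have "\<kappa> \<phi> \<otimes>\<^bsub>H\<^esub> part (word \<phi>) {..<n} x = finprod H (\<lambda>i. ?u i s0 \<otimes>\<^bsub>H\<^esub> word \<phi> i (x i)) {..<n}"
        unfolding part_def using u SG s0 words_closed[OF word[OF \<phi>]] xi
        by (simp add: H.finprod_multf Pi_iff)
      also have "\<dots> = finprod H (\<lambda>i. ?u i (x i)) {..<n}"
      proof (rule H.finprod_cong')
        fix i assume "i \<in> {..<n}"
        then show "?u i s0 \<otimes>\<^bsub>H\<^esub> word \<phi> i (x i) = ?u i (x i)"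
          using u SG s0 xi[of i] by (simp add: word_def norm_def H.m_lcomm[of "?u i s0"])
      qed (use u SG xi in auto)
      also have "\<dots> = \<phi> x"
        by (rule hom_group_power_eq[OF \<open>comm_group G\<close> \<open>comm_group H\<close> \<phi> OP[OF x], symmetric])
      finally show ?thesis by simp
    qed
    define encode where "encode c = (word (fst c), {u \<in> carrier H. \<kappa> (fst c) \<otimes>\<^bsub>H\<^esub> u \<in> snd c})"
      for c :: "((nat \<Rightarrow> 'a) \<Rightarrow> 'h) \<times> 'h set"
    have encode: "satisfies x c \<longleftrightarrow> holds n {encode c} x" if "c \<in> conditions G n H" "x \<in> ?O" for c x
    proof -
      have \<phi>: "fst c \<in> hom ?P H" using that(1) by (auto simp: conditions_def)
      have "part (word (fst c)) {..<n} x \<in> carrier H"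
        using words_closed[OF word[OF \<phi>]] set_powerD[OF that(2)] by (intro part_closed) auto
      then show ?thesis using split[OF \<phi> that(2)] by (simp add: satisfies_def holds_def encode_def)
    qed
    have all: "satisfies_all x \<C> \<longleftrightarrow> holds n (encode ` \<C>) x" if "\<C> \<subseteq> conditions G n H" "x \<in> ?O" for \<C> x
    proof -
      have "satisfies_all x \<C> \<longleftrightarrow> (\<forall>c\<in>\<C>. holds n {encode c} x)"
        unfolding satisfies_all_def using encode that by blast
      then show ?thesis by (auto simp: holds_def)
    qed
    have decode: "\<exists>c\<in>conditions G n H. \<forall>x\<in>?O. satisfies x c \<longleftrightarrow> holds n {d} x"
      if d: "d \<in> letter_conditions n" for d
    proof -
      obtain w E where dwE: "d = (w, E)" "w \<in> words n" "E \<subseteq> carrier H"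
        using d by (auto simp: letter_conditions_def)
      have "\<forall>i\<in>{..<n}. w i \<in> M" using dwE(2) by (simp add: words_def)
      then have "\<forall>i\<in>{..<n}. \<exists>f. f \<in> hom G H \<and> w i = norm f" unfolding M_def by blast
      then obtain f where f: "\<forall>i\<in>{..<n}. f i \<in> hom G H \<and> w i = norm (f i)" by (auto dest!: bchoice)
      then obtain \<psi> where \<psi>: "\<psi> \<in> hom ?P H" "\<psi> \<in> extensional (carrier ?P)"
          "\<forall>i<n. \<forall>a\<in>carrier G. \<psi> (unit_point G n i a) = f i a"
        using ex_hom_group_power[OF \<open>comm_group G\<close> \<open>comm_group H\<close>, of n f] by auto
      have "word \<psi> i = w i" if "i < n" for i
        using f \<psi>(3) that SG s0 by (auto simp: word_def norm_def intro!: restrict_ext)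
      then have part: "part (word \<psi>) {..<n} x = part w {..<n} x" if "x \<in> ?O" for x
        unfolding part_def using words_closed[OF dwE(2)] set_powerD[OF that] by (intro H.finprod_cong') auto
      let ?c = "(\<psi>, (\<lambda>u. \<kappa> \<psi> \<otimes>\<^bsub>H\<^esub> u) ` E)"
      have "?c \<in> conditions G n H" using \<psi> \<kappa>[OF \<psi>(1)] dwE(3) by (auto simp: conditions_def)
      moreover have "satisfies x ?c \<longleftrightarrow> holds n {d} x" if x: "x \<in> ?O" for x
      proof -
        have p: "part w {..<n} x \<in> carrier H"
          using words_closed[OF dwE(2)] set_powerD[OF x] by (intro part_closed) auto
        have "\<kappa> \<psi> \<otimes>\<^bsub>H\<^esub> part w {..<n} x \<in> (\<lambda>u. \<kappa> \<psi> \<otimes>\<^bsub>H\<^esub> u) ` E \<longleftrightarrow> part w {..<n} x \<in> E"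
          using p \<kappa>[OF \<psi>(1)] dwE(3) by (auto simp: subset_iff)
        then show ?thesis
          using split[OF \<psi>(1) x] part[OF x] dwE(1) by (simp add: satisfies_def holds_def)
      qed
      ultimately show ?thesis by blast
    qed
    have "encode ` \<G> \<subseteq> letter_conditions n"
      using GC word by (auto simp: encode_def letter_conditions_def conditions_def)
    from A[OF this] obtain F where F: "F \<subseteq> letter_conditions n" "finite F" "card F \<le> A"
        "\<forall>x\<in>?O. holds n F x \<longrightarrow> holds n (encode ` \<G>) x"
        "real (card {x \<in> ?O. holds n (encode ` \<G>) x \<and> \<not> holds n F x}) \<le> \<epsilon> * real (card ?O)"
      unfolding approximable_def by (elim exE conjE) rule
    have "\<forall>d\<in>F. \<exists>c. c \<in> conditions G n H \<and> (\<forall>x\<in>?O. satisfies x c \<longleftrightarrow> holds n {d} x)"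
      using decode F(1) by blast
    then obtain dec where dec: "\<forall>d\<in>F. dec d \<in> conditions G n H \<and> (\<forall>x\<in>?O. satisfies x (dec d) \<longleftrightarrow> holds n {d} x)"
      by (auto dest!: bchoice)
    have decF: "satisfies_all x (dec ` F) \<longleftrightarrow> holds n F x" if "x \<in> ?O" for x
      using dec that by (auto simp: satisfies_all_def holds_def)
    have "{x \<in> ?O. satisfies_all x \<G> \<and> \<not> satisfies_all x (dec ` F)}
        = {x \<in> ?O. holds n (encode ` \<G>) x \<and> \<not> holds n F x}"
      using all[OF GC] decF by blast
    then have "internally_approximates \<epsilon> S n (dec ` F) \<G>"
      unfolding internally_approximates_def using F(4,5) all[OF GC] decF by simp
    moreover have "card (dec ` F) \<le> A" using card_image_le[OF F(2), of dec] F(3) by linarith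
    moreover have "dec ` F \<subseteq> conditions G n H" using dec by blast
    ultimately show ?thesis using F(2) by (intro exI[of _ "dec ` F"]) simp
  qed
  then show ?thesis by (intro exI[of _ A]) blast
qed

end
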